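(* Let $\mathcal{L}$ be a finite relational language with relation symbols of any finite arities, and let $\mathcal{K}$ be a Fraïssé class of finite $\mathcal{L}$-structures such that its Fraïssé limit $\mathbf{K}$ satisfies SDAP$^+$. Then $\mathbf{K}$ is indivisible; that is, for every singleton substructure $\mathbf{A}$ of $\mathbf{K}$, every positive integer $\ell$, and every coloring of the set of all substructures of $\mathbf{K}$ isomorphic to $\mathbf{A}$ into $\ell$ colors, there is a substructure $\mathbf{K}'$ of $\mathbf{K}$ with $\mathbf{K}'\cong\mathbf{K}$ such that all substructures of $\mathbf{K}'$ isomorphic to $\mathbf{A}$ have the same color.
   Context: **Standing conventions.** $\omega=\{0,1,2,\dots\}$. $\mathcal{L}$ is a finite relational language with at least one relation symbol of arity greater than one. A Fraïssé class is a nonempty class of finite $\mathcal{L}$-structures closed under isomorphism, hereditary, with the joint embedding and amalgamation properties; all Fraïssé classes are assumed to have the Disjoint Amalgamation Property (for embeddings $f:\mathbf{A}\to\mathbf{B}$, $g:\mathbf{A}\to\mathbf{C}$ in $\mathcal{K}$ there are $\mathbf{D}\in\mathcal{K}$ and embeddings $r:\mathbf{B}\to\mathbf{D}$, $s:\mathbf{C}\to\mathbf{D}$ with $r\circ f=s\circ g$ and $r[\mathrm{B}]\cap s[\mathrm{C}]=r\circ f[\mathrm{A}]$). $\mathbf{K}$ is the (countably infinite) Fraïssé limit of $\mathcal{K}$, enumerated, i.e. with universe $\omega$; write $v_n$ for the $n$-th vertex and $\mathbf{K}_n$ for the substructure on $\{v_i:i<n\}$. Relations of $\mathbf{K}$ hold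 only of tuples of distinct elements, and every relation symbol holds of some tuple of distinct elements and fails of some other. If $\mathcal{L}$ has unary relation symbols, there are at least two of them and every vertex of every member of $\mathcal{K}$ satisfies exactly one. All types are quantifier-free $1$-types (in the variable $x$) over finite parameter sets, realizable in $\mathbf{K}$; $\mathrm{tp}$ denotes a complete one. $\Gamma$ is the set of complete parameter-free $1$-types realized in $\mathbf{K}$. **SDAP.** $\mathcal{K}$ has SDAP (Substructure Disjoint Amalgamation Property) if it has disjoint amalgamation and: given $\mathbf{A},\mathbf{C}\in\mathcal{K}$ where $\mathbf{A}$ is a substructure of $\mathbf{C}$ and $\mathbf{C}$ extends $\mathbf{A}$ by two vertices $v,w$, there exist $\mathbf{A}',\mathbf{C}'\in\mathcal{K}$, where $\mathbf{A}'$ contains a copy of $\mathbf{A}$ as a substructure and $\mathbf{C}'$ is a disjoint amalgamation of $\mathbf{A}'$ and $\mathbf{C}$ over $\mathbf{A}$, such that, letting $v',w'$ be the two vertices of $\mathrm{C}'\setminus\mathrm{A}'$ (corresponding to $v,w$): whenever (1) $\mathbf{B}\in\mathcal{K}$ contains $\mathbf{A}'$ as a substructure and $\sigma,\tau$ are $1$-types over $\mathbf{B}$ with $\sigma\upharpoonright\mathbf{A}'=\mathrm{tp}(v'/\mathbf{A}')$, $\tau\upharpoonright\mathbf{A}'=\mathrm{tp}(w'/\mathbf{A}')$, and (2) $\mathbf{D}\in\mathcal{K}$ extends $\mathbf{B}$ by one vertex $v''$ with $\mathrm{tp}(v''/\mathbf{B})=\sigma$, then there is $\mathbf{E}\in\mathcal{K}$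 extending $\mathbf{D}$ by one vertex $w''$ such that $\mathrm{tp}(w''/\mathbf{B})=\tau$ and $\mathbf{E}\upharpoonright(\mathrm{A}\cup\{v'',w''\})\cong\mathbf{C}$. **Coding trees.** $\mathbb{S}=\mathbb{S}(\mathbf{K})$ is the set of all complete $1$-types over initial segments $\mathbf{K}_n$, $n<\omega$, ordered by inclusion; $\mathbb{S}(n)$ is the set of types $\mathrm{tp}(v_i/\mathbf{K}_n)$, $i\ge n$. The $n$-th coding node is $c_n=\mathrm{tp}(v_n/\mathbf{K}_n)$; it represents the vertex $v_n$. Let $\mathcal{L}^-$ be the set of symbols of arity $>1$ and $\mathbf{K}^-,\mathbf{K}^-_n$ the reducts to $\mathcal{L}^-$. $\mathbb{U}=\mathbb{U}(\mathbf{K})=\bigcup_n\mathbb{U}(n)$, where $\mathbb{U}(n)$ is the set of complete $1$-types over $\mathbf{K}^-_n$ in $\mathcal{L}^-$ satisfied by some $v_i$, $i\ge n$, ordered by inclusion; its $n$-th coding node $c_n$ is the $\mathcal{L}^-$-type of $v_n$ over $\mathbf{K}_n^-$ together with the additional color $\gamma\in\Gamma$ such that $\gamma(v_n)$ holds. Everything below applies to both $\mathbb{S}$ and $\mathbb{U}$. A node $s$ of level $n$ has length $|s|=n+1$. $s(0)$ is the set of parameter-free formulas of $s$; for $1\le i<|s|$, $s(i)$ is the set of formulas of $s\upharpoonright\mathbf{K}_i$ in which $v_{i-1}$ appears; $s\upharpoonright\ell=\bigcup_{i<\ell}s(i)$. The meet $s\wedge t$ is the longest common initial segment $s\upharpoonright\ell=t\upharpoonright\ell$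 (if $s(0)\ne t(0)$ it is the empty sequence, not counted as a node). A level set is a set of nodes of the same length. The order $\prec$: fix a linear order on relation symbols and negated relation symbols with negated symbols first, order $\{x\}\cup\omega$ by $x$ first, and order atomic and negated atomic formulas with one variable $x$ lexicographically; $\prec$ is the induced lexicographic order on nodes, so that $s\subsetneq t$ implies $s\prec t$, and for incomparable $s,t$ with $|s\wedge t|=n$, $s\prec t$ iff $s\upharpoonright(n+1)\prec t\upharpoonright(n+1)$. **Subtrees.** A subset $T$ is a subtree if it is closed under meets and, for each $\ell$ that is the length of a coding node in $T$ or of a meet of two incomparable nodes of $T$, and each $t\in T$ with $|t|\ge\ell$, $t\upharpoonright\ell\in T$. $\langle c^T_n\rangle$ enumerates the coding nodes in $T$ by increasing length, $\ell^T_n=|c^T_n|$; $\mathrm{N}^T=\{i:c_i\in T\}$, $\mathrm{N}^T_n$ is the set of indices of the first $n$ coding nodes in $T$ (similarly for arbitrary subsets), and $\mathbf{K}\upharpoonright T$ is the substructure of $\mathbf{K}$ on $\mathrm{N}^T$. $\widehat{T}=\{t\upharpoonright n:t\in T,1\le n\le|t|\}$; splitting and immediate successors in $T$ are computed in $\widehat T$. $T\upharpoonright\ell$ is the set of nodes of $\widehat{T}$ of length $\ell$ and $T\downarrow\ell=\{t\in T:|t|<\ell\}\cup T\upharpoonright\ell$. $T$ is diagonal if each level has at most one splitting node, splitting nodes have exactly two immediate successors, and levels of coding nodes have no splitting node. If $s\in T$ is not splitting, $s^+$ is its immediate successor in $\widehat T$. Critical nodes are splitting or coding nodes. $T$ is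 perfect if it has no terminal nodes and each node has at least two incomparable extensions. **Passing types.** For a coding node $c_n$ with $|c_n|<|t|$ and a set $A$, $t(c_n;A)$ is the set of formulas in $t(|c_n|)$ all of whose parameters are among $\{v_i:i\in\mathrm{N}^A_m\cup\{n\}\}$, $m$ least with $|c^A_m|\ge|c_n|$ (use $\mathrm{N}^A$ if there is no such $m$); $t(n;A):=t(c^A_n;A)$. Suppose $\mathrm{N}^A\cap m$ and $\mathrm{N}^B\cap n$ have the same size $p$; let $f$ be the increasing bijection $\mathrm{N}^A_p\to\mathrm{N}^B_p$ extended by $m\mapsto n$, $x\mapsto x$. Then $s(c_m;A)\sim t(c_n;B)$ means: for every $R\in\mathcal{L}$ of arity $k$ and every $k$-tuple $(z_0,\dots,z_{k-1})$ from $\{v_i:i\in\mathrm{N}^A_p\cup\{m\}\}\cup\{x\}$ with some $z_i=x$, $R(z_0,\dots,z_{k-1})\in s(c_m;A)$ iff $R(f(z_0),\dots,f(z_{k-1}))\in t(c_n;B)$. $s(n;A)\sim t(n;B)$ means $s(c^A_n;A)\sim t(c^B_n;B)$. **Similarity.** For meet-closed $S,T$, $f:S\to T$ is a similarity map if it is a bijection preserving (both ways) $\prec$, meets, relative lengths ($|s|<|t|$ iff $|f(s)|<|f(t)|$), and initial segments; $f(c^S_n)=c^T_n$ and the vertices represented by $c^S_n,c^T_n$ satisfy the same $\gamma\in\Gamma$; and $s(n;S)\sim f(s)(n;T)$ whenever $|c^S_n|<|s|$. $S\sim T$ means such a map exists. **Diagonal coding subtree.** A diagonal subtree $T\subseteq\mathbb{U}$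 such that (1) $\mathbf{K}\upharpoonright T\cong\mathbf{K}$; (2) for each $n$, the collection of $1$-types in $T\upharpoonright(\ell^T_n+1)$ over $\mathbf{K}\upharpoonright(T\downarrow\ell^T_n)$ is in one-to-one correspondence with the collection of $1$-types in $\mathbb{U}(n+1)$; (3) if $m<n$, $A=T\downarrow(\ell^T_m-1)$ and $c^T_n\supseteq c^T_m$, then $(c^T_n)^+(c^T_n;A)\sim(c^T_m)^+(c^T_m;A)$. Likewise for $T\subseteq\mathbb{S}$, with $\mathbb{S}$ in place of $\mathbb{U}$. **Diagonal Coding Tree Property:** for any enumeration of $\mathbf{K}$ there is a perfect diagonal coding subtree of $\mathbb{S}$ or of $\mathbb{U}$. **Extension Property.** Let $\mathbb{T}$ be a fixed diagonal coding subtree of $\mathbb{S}$ or, if none exists, of $\mathbb{U}$ with all unary relations occurring densely in $\mathbb{T}$. $\mathcal{T}$ is the set of subtrees $T$ of $\mathbb{T}$ with $T\sim\mathbb{T}$. For finite $A\subseteq T$, $\ell_A=\max\{|t|:t\in A\}$, $\max(A)=\{s\in A:|s|=\ell_A\}$, and $\max(A)^+$ is the set of nodes in $T\upharpoonright(\ell_A+1)$ extending a node of $\max(A)$. For a subtree $A$, $r_k(A)$ is the restriction of $A$ to the levels of its first $k$ critical nodes. Finite subtrees $A,B$ of $T$ are $+$-similar if $A\sim B$ and: if $\max(A)$ has a splitting node of $T$ then so does $\max(B)$ and the similarity map sends the one to the other; if $\max(A)$ has a coding node $c^A_n$ and $f:A\to B$ is the similarity map, then $s^+(n;A)\sim f(s)^+(n;B)$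 for each $s\in\max(A)$. (EP): Suppose $A$ is a finite or infinite subtree of some $T\in\mathcal{T}$, $k$ is given, $\max(r_{k+1}(A))$ has a splitting node $u$, and $B$ is a $+$-similarity copy of $r_k(A)$ in $T$. Let $s$ be the node of $\max(B)^+$ that must be extended to a splitting node to obtain a $+$-similarity copy of $r_{k+1}(A)$. If $s^*$ is a splitting node in $T$ extending $s$, then there are extensions of the remaining nodes of $\max(B)^+$ to the length of $s^*$ resulting in a $+$-similarity copy of $r_{k+1}(A)$ which can be extended to a copy of $A$. $\mathbf{K}$ has the Extension Property if (EP) holds for such a choice of $\mathbb{T}$. **SDAP$^+$.** $\mathbf{K}$ satisfies SDAP$^+$ if its age satisfies SDAP and $\mathbf{K}$ has the Diagonal Coding Tree Property and the Extension Property (with $\mathbb{T}$ perfect). This does not depend on the enumeration of $\mathbf{K}$. *)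

theory Defs
  imports "HOL-Library.Infinite_Set" "HOL-Library.Option_ord"
begin

section \<open>Relational structures\<close>

record 'r lang =
  syms :: "'r set"
  arity :: "'r \<Rightarrow> nat"

record ('r, 'a) struct =
  univ :: "'a set"
  holds :: "'r \<Rightarrow> 'a list \<Rightarrow> bool"

definition relational_language :: "'r lang \<Rightarrow> bool" where
  "relational_language L \<longleftrightarrow>
     finite (syms L) \<and> (\<forall>R\<in>syms L. arity L R \<ge> 1) \<and> (\<exists>R\<in>syms L. arity L R > 1)"

text \<open>Nothing holds outside the universe, at the wrong arity, or for a symbol not in the language.
  Hence a structure is determined by its universe and its relations.\<close>

definition structure_for :: "'r lang \<Rightarrow> ('r, 'a) struct \<Rightarrow> bool" where
  "structure_for L M \<longleftrightarrow>
     (\<forall>R ts. holds M R ts \<longrightarrow> R \<in> syms L \<and> length ts = arity L R \<and> set ts \<subseteq> univ M)"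

definition induced :: "('r, 'a) struct \<Rightarrow> 'a set \<Rightarrow> ('r, 'a) struct" where
  "induced M X = \<lparr>univ = univ M \<inter> X, holds = (\<lambda>R ts. holds M R ts \<and> set ts \<subseteq> univ M \<inter> X)\<rparr>"

definition substructure :: "('r, 'a) struct \<Rightarrow> ('r, 'a) struct \<Rightarrow> bool" where
  "substructure N M \<longleftrightarrow> univ N \<subseteq> univ M \<and> N = induced M (univ N)"

definition embedding ::
    "'r lang \<Rightarrow> ('a \<Rightarrow> 'b) \<Rightarrow> ('r, 'a) struct \<Rightarrow> ('r, 'b) struct \<Rightarrow> bool" where
  "embedding L f M N \<longleftrightarrow>
     inj_on f (univ M) \<and> f ` univ M \<subseteq> univ N \<and>
     (\<forall>R\<in>syms L. \<forall>ts. length ts = arity L R \<and> set ts \<subseteq> univ M \<longrightarrow>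
        (holds M R ts \<longleftrightarrow> holds N R (map f ts)))"

definition isomorphism ::
    "'r lang \<Rightarrow> ('a \<Rightarrow> 'b) \<Rightarrow> ('r, 'a) struct \<Rightarrow> ('r, 'b) struct \<Rightarrow> bool" where
  "isomorphism L f M N \<longleftrightarrow> embedding L f M N \<and> f ` univ M = univ N"

definition isomorphic :: "'r lang \<Rightarrow> ('r, 'a) struct \<Rightarrow> ('r, 'b) struct \<Rightarrow> bool" where
  "isomorphic L M N \<longleftrightarrow> (\<exists>f. isomorphism L f M N)"


section \<open>Fraisse classes and limits\<close>

text \<open>Every finite structure is isomorphic to one whose universe is a finite set of natural numbers
  (the empty structure included), so a class of finite structures closed under isomorphism is given
  by a set of such structures.\<close>

definition disjoint_amalgamation_property :: "'r lang \<Rightarrow> ('r, nat) struct set \<Rightarrow> bool" where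
  "disjoint_amalgamation_property L \<K> \<longleftrightarrow>
     (\<forall>A\<in>\<K>. \<forall>B\<in>\<K>. \<forall>C\<in>\<K>. \<forall>f g. embedding L f A B \<and> embedding L g A C \<longrightarrow>
        (\<exists>D\<in>\<K>. \<exists>r s. embedding L r B D \<and> embedding L s C D \<and>
           (\<forall>a\<in>univ A. r (f a) = s (g a)) \<and>
           r ` univ B \<inter> s ` univ C = r ` f ` univ A))"

definition amalgamation_property :: "'r lang \<Rightarrow> ('r, nat) struct set \<Rightarrow> bool" where
  "amalgamation_property L \<K> \<longleftrightarrow>
     (\<forall>A\<in>\<K>. \<forall>B\<in>\<K>. \<forall>C\<in>\<K>. \<forall>f g. embedding L f A B \<and> embedding L g A C \<longrightarrow>
        (\<exists>D\<in>\<K>. \<exists>r s. embedding L r B D \<and> embedding L s C D \<and>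
           (\<forall>a\<in>univ A. r (f a) = s (g a))))"

definition joint_embedding_property :: "'r lang \<Rightarrow> ('r, nat) struct set \<Rightarrow> bool" where
  "joint_embedding_property L \<K> \<longleftrightarrow>
     (\<forall>B\<in>\<K>. \<forall>C\<in>\<K>. \<exists>D\<in>\<K>. \<exists>r s. embedding L r B D \<and> embedding L s C D)"

definition fraisse_class :: "'r lang \<Rightarrow> ('r, nat) struct set \<Rightarrow> bool" where
  "fraisse_class L \<K> \<longleftrightarrow>
     \<K> \<noteq> {} \<and>
     (\<forall>A\<in>\<K>. structure_for L A \<and> finite (univ A)) \<and>
     (\<forall>A\<in>\<K>. \<forall>B. structure_for L B \<and> isomorphic L A B \<longrightarrow> B \<in> \<K>) \<and>
     (\<forall>A\<in>\<K>. \<forall>B. substructure B A \<longrightarrow> B \<in> \<K>) \<and>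
     joint_embedding_property L \<K> \<and>
     amalgamation_property L \<K> \<and>
     disjoint_amalgamation_property L \<K>"

definition age :: "'r lang \<Rightarrow> ('r, nat) struct \<Rightarrow> ('r, nat) struct set" where
  "age L M = {A. structure_for L A \<and> finite (univ A) \<and> (\<exists>f. embedding L f A M)}"

definition ultrahomogeneous :: "'r lang \<Rightarrow> ('r, 'a) struct \<Rightarrow> bool" where
  "ultrahomogeneous L M \<longleftrightarrow>
     (\<forall>X Y f. finite X \<and> X \<subseteq> univ M \<and> Y \<subseteq> univ M \<and>
        isomorphism L f (induced M X) (induced M Y) \<longrightarrow>
        (\<exists>g. isomorphism L g M M \<and> (\<forall>x\<in>X. g x = f x)))"

text \<open>Enumerated structures have universe \<^term>\<open>UNIV :: nat set\<close>; the vertex \<open>v\<^sub>n\<close> is \<open>n\<close>.\<close>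

definition enumerated_fraisse_limit ::
    "'r lang \<Rightarrow> ('r, nat) struct set \<Rightarrow> ('r, nat) struct \<Rightarrow> bool" where
  "enumerated_fraisse_limit L \<K> K \<longleftrightarrow>
     structure_for L K \<and> univ K = UNIV \<and> age L K = \<K> \<and> ultrahomogeneous L K"

definition standing_conventions ::
    "'r lang \<Rightarrow> ('r, nat) struct set \<Rightarrow> ('r, nat) struct \<Rightarrow> bool" where
  "standing_conventions L \<K> K \<longleftrightarrow>
     (\<forall>R ts. holds K R ts \<longrightarrow> distinct ts) \<and>
     (\<forall>R\<in>syms L.
        (\<exists>ts. distinct ts \<and> length ts = arity L R \<and> set ts \<subseteq> univ K \<and> holds K R ts) \<and>
        (\<exists>ts. distinct ts \<and> length ts = arity L R \<and> set ts \<subseteq> univ K \<and> \<not> holds K R ts)) \<and>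
     ((\<exists>R\<in>syms L. arity L R = 1) \<longrightarrow>
        (\<exists>R\<in>syms L. \<exists>R'\<in>syms L. arity L R = 1 \<and> arity L R' = 1 \<and> R \<noteq> R') \<and>
        (\<forall>A\<in>\<K>. \<forall>v\<in>univ A. \<exists>!R. R \<in> syms L \<and> arity L R = 1 \<and> holds A R [v]))"


section \<open>Quantifier-free 1-types\<close>

text \<open>The term \<^term>\<open>None\<close> is the variable \<open>x\<close>, and \<^term>\<open>Some a\<close> is the parameter \<open>a\<close>.  A literal
  \<open>(b, R, z)\<close> is \<open>R(z)\<close> if \<open>b\<close> is true and its negation otherwise.\<close>

type_synonym 'r literal = "bool \<times> 'r \<times> nat option list"

definition lit_params :: "'r literal \<Rightarrow> nat set" where
  "lit_params \<phi> = {a. Some a \<in> set (snd (snd \<phi>))}"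

text \<open>The complete type of a vertex \<open>v\<close> outside \<open>P\<close> over the parameter set \<open>P\<close>.  It consists of the
  literals in which \<open>x\<close> occurs.  Equality literals are omitted, since \<open>v\<close> is not a parameter.\<close>

definition tp :: "'r lang \<Rightarrow> ('r, nat) struct \<Rightarrow> nat \<Rightarrow> nat set \<Rightarrow> 'r literal set" where
  "tp L M v P =
     {(b, R, zs). R \<in> syms L \<and> length zs = arity L R \<and> None \<in> set zs \<and>
        set zs \<subseteq> insert None (Some ` P) \<and>
        b = holds M R (map (\<lambda>z. case z of None \<Rightarrow> v | Some a \<Rightarrow> a) zs)}"

definition type_restrict :: "'r literal set \<Rightarrow> nat set \<Rightarrow> 'r literal set" where
  "type_restrict \<sigma> P = {\<phi>\<in>\<sigma>. lit_params \<phi> \<subseteq> P}"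

definition one_vertex_extension ::
    "('r, nat) struct \<Rightarrow> nat \<Rightarrow> ('r, nat) struct \<Rightarrow> bool" where
  "one_vertex_extension B v D \<longleftrightarrow>
     v \<notin> univ B \<and> univ D = insert v (univ B) \<and> substructure B D"

text \<open>For a class with limit \<open>K\<close>, a type over \<open>B\<close> is realizable in \<open>K\<close> iff it is realized in a
  one-vertex extension of \<open>B\<close> belonging to the class.\<close>

definition types_over ::
    "'r lang \<Rightarrow> ('r, nat) struct set \<Rightarrow> ('r, nat) struct \<Rightarrow> 'r literal set set" where
  "types_over L \<K> B = {tp L F v (univ B) | F v. F \<in> \<K> \<and> one_vertex_extension B v F}"


section \<open>The Substructure Disjoint Amalgamation Property\<close>

text \<open>Below \<open>e\<close> gives the copy of \<open>A\<close> inside \<open>A'\<close>, and \<open>i\<close> embeds \<open>C\<close> in \<open>C'\<close>, so that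
  \<open>v' = i v\<close> and \<open>w' = i w\<close>.\<close>

definition SDAP :: "'r lang \<Rightarrow> ('r, nat) struct set \<Rightarrow> bool" where
  "SDAP L \<K> \<longleftrightarrow>
     disjoint_amalgamation_property L \<K> \<and>
     (\<forall>A\<in>\<K>. \<forall>C\<in>\<K>. \<forall>v w.
        substructure A C \<and> v \<noteq> w \<and> v \<notin> univ A \<and> w \<notin> univ A \<and>
        univ C = univ A \<union> {v, w} \<longrightarrow>
        (\<exists>A'\<in>\<K>. \<exists>C'\<in>\<K>. \<exists>e i.
           embedding L e A A' \<and> substructure A' C' \<and> embedding L i C C' \<and>
           (\<forall>a\<in>univ A. i a = e a) \<and>
           univ A' \<inter> i ` univ C = e ` univ A \<and>
           univ C' = univ A' \<union> {i v, i w} \<and>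
           (\<forall>B\<in>\<K>. \<forall>\<sigma>\<in>types_over L \<K> B. \<forall>\<tau>\<in>types_over L \<K> B. \<forall>D\<in>\<K>. \<forall>v''.
              substructure A' B \<and>
              type_restrict \<sigma> (univ A') = tp L C' (i v) (univ A') \<and>
              type_restrict \<tau> (univ A') = tp L C' (i w) (univ A') \<and>
              one_vertex_extension B v'' D \<and> tp L D v'' (univ B) = \<sigma> \<longrightarrow>
              (\<exists>E\<in>\<K>. \<exists>w''. one_vertex_extension D w'' E \<and> tp L E w'' (univ B) = \<tau> \<and>
                 isomorphic L (induced E (e ` univ A \<union> {v'', w''})) C))))"


section \<open>Nodes as sequences of sets of literals\<close>

definition params :: "'r literal set \<Rightarrow> nat set" where
  "params s = (\<Union>\<phi>\<in>s. lit_params \<phi>)"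

text \<open>A type over \<open>K\<^sub>n\<close> mentions each of its \<open>n\<close> parameters, because some symbol has arity greater
  than one.  Hence its length \<open>n + 1\<close> can be read off from the set of literals.  The empty set stands
  for the empty sequence.\<close>

definition len :: "'r literal set \<Rightarrow> nat" where
  "len s = (if s = {} then 0 else Suc (card (params s)))"

fun entry :: "'r literal set \<Rightarrow> nat \<Rightarrow> 'r literal set" where
  "entry s 0 = {\<phi>\<in>s. lit_params \<phi> = {}}"
| "entry s (Suc j) = {\<phi>\<in>s. j \<in> lit_params \<phi> \<and> lit_params \<phi> \<subseteq> {..j}}"

definition seg :: "'r literal set \<Rightarrow> nat \<Rightarrow> 'r literal set" where
  "seg s l = (\<Union>i<l. entry s i)"

definition meet_len :: "'r literal set \<Rightarrow> 'r literal set \<Rightarrow> nat" where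
  "meet_len s t = (GREATEST l. l \<le> len s \<and> l \<le> len t \<and> seg s l = seg t l)"

definition meet :: "'r literal set \<Rightarrow> 'r literal set \<Rightarrow> 'r literal set" where
  "meet s t = seg s (meet_len s t)"

definition incomparable :: "'r literal set \<Rightarrow> 'r literal set \<Rightarrow> bool" where
  "incomparable s t \<longleftrightarrow> \<not> s \<subseteq> t \<and> \<not> t \<subseteq> s"

text \<open>The fixed (strict) linear order of the symbols \<open>(True, R)\<close> and negated symbols
  \<open>(False, R)\<close>.\<close>

definition symbol_order :: "'r lang \<Rightarrow> (bool \<times> 'r) rel \<Rightarrow> bool" where
  "symbol_order L ord \<longleftrightarrow>
     strict_linear_order_on (UNIV \<times> syms L) ord \<and>
     (\<forall>R\<in>syms L. \<forall>R'\<in>syms L. ((False, R), (True, R')) \<in> ord)"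

definition literal_less :: "(bool \<times> 'r) rel \<Rightarrow> 'r literal rel" where
  "literal_less ord =
     {((b, R, zs), (b', R', zs')).
        (((b, R), zs), ((b', R'), zs')) \<in> ord <*lex*> lexord {(z, z'). z < z'}}"

text \<open>Entries are compared lexicographically along their increasing enumerations: at the first
  literal on which the two entries differ, the entry containing it comes first.\<close>

definition prec :: "(bool \<times> 'r) rel \<Rightarrow> 'r literal set \<Rightarrow> 'r literal set \<Rightarrow> bool" where
  "prec ord s t \<longleftrightarrow>
     s \<subset> t \<or>
     incomparable s t \<and>
     (let n = meet_len s t in
        \<exists>\<phi>\<in>entry s n - entry t n.
          \<forall>\<psi>. (\<psi>, \<phi>) \<in> literal_less ord \<longrightarrow> (\<psi> \<in> entry s n \<longleftrightarrow> \<psi> \<in> entry t n))"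


section \<open>Coding trees\<close>

definition non_unary :: "'r lang \<Rightarrow> 'r lang" where
  "non_unary L = L\<lparr>syms := {R\<in>syms L. arity L R > 1}\<rparr>"

text \<open>\<open>L\<close> is the language of the enumerated structure \<open>M\<close>, and \<open>LT\<close> is the language of the nodes:
  \<open>LT = L\<close> gives the tree \<open>\<S>(M)\<close>, and \<open>LT = non_unary L\<close> gives \<open>\<U>(M)\<close>.  In the latter case the
  color of a coding node is not part of the node; it is recovered from the index of the node, as
  the parameter-free \<open>L\<close>-type of the vertex it represents.\<close>

locale coding_tree =
  fixes L :: "'r lang" and LT :: "'r lang"
    and ord :: "(bool \<times> 'r) rel"
    and M :: "('r, nat) struct"
begin

definition level :: "nat \<Rightarrow> 'r literal set set" where
  "level n = {tp LT M i {..<n} | i. n \<le> i}"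

definition tree :: "'r literal set set" where
  "tree = (\<Union>n. level n)"

definition code :: "nat \<Rightarrow> 'r literal set" where
  "code n = tp LT M n {..<n}"

definition color :: "nat \<Rightarrow> 'r literal set" where
  "color n = tp L M n {}"

definition coded :: "'r literal set set \<Rightarrow> nat set" where
  "coded A = {i. code i \<in> A}"

text \<open>\<open>idx A n\<close> is the index of the \<open>n\<close>-th coding node in \<open>A\<close>, meaningful if \<open>has_idx A n\<close>.\<close>

definition has_idx :: "'r literal set set \<Rightarrow> nat \<Rightarrow> bool" where
  "has_idx A n \<longleftrightarrow> infinite (coded A) \<or> n < card (coded A)"

definition idx :: "'r literal set set \<Rightarrow> nat \<Rightarrow> nat" where
  "idx A n = Infinite_Set.enumerate (coded A) n"

definition code_len :: "'r literal set set \<Rightarrow> nat \<Rightarrow> nat" where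
  "code_len A n = len (code (idx A n))"


subsection \<open>Subtrees\<close>

definition meet_closed :: "'r literal set set \<Rightarrow> bool" where
  "meet_closed A \<longleftrightarrow> (\<forall>s\<in>A. \<forall>t\<in>A. meet s t \<noteq> {} \<longrightarrow> meet s t \<in> A)"

definition subtree :: "'r literal set set \<Rightarrow> bool" where
  "subtree A \<longleftrightarrow>
     A \<subseteq> tree \<and> meet_closed A \<and>
     (\<forall>l. (\<exists>i\<in>coded A. l = len (code i)) \<or>
          (\<exists>s\<in>A. \<exists>t\<in>A. incomparable s t \<and> meet s t \<noteq> {} \<and> l = len (meet s t)) \<longrightarrow>
        (\<forall>t\<in>A. l \<le> len t \<longrightarrow> seg t l \<in> A))"

definition hat :: "'r literal set set \<Rightarrow> 'r literal set set" where
  "hat A = {seg t n | t n. t \<in> A \<and> 1 \<le> n \<and> n \<le> len t}"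

definition at_len :: "'r literal set set \<Rightarrow> nat \<Rightarrow> 'r literal set set" where
  "at_len A l = {t\<in>hat A. len t = l}"

definition down :: "'r literal set set \<Rightarrow> nat \<Rightarrow> 'r literal set set" where
  "down A l = {t\<in>A. len t < l} \<union> at_len A l"

definition succs :: "'r literal set set \<Rightarrow> 'r literal set \<Rightarrow> 'r literal set set" where
  "succs A s = {t\<in>hat A. s \<subseteq> t \<and> len t = Suc (len s)}"

definition splitting :: "'r literal set set \<Rightarrow> 'r literal set \<Rightarrow> bool" where
  "splitting A s \<longleftrightarrow> s \<in> hat A \<and> (\<exists>t\<in>succs A s. \<exists>u\<in>succs A s. t \<noteq> u)"

definition succ :: "'r literal set set \<Rightarrow> 'r literal set \<Rightarrow> 'r literal set" where
  "succ A s = (THE t. t \<in> succs A s)"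

definition diagonal :: "'r literal set set \<Rightarrow> bool" where
  "diagonal A \<longleftrightarrow>
     (\<forall>s t. splitting A s \<and> splitting A t \<and> len s = len t \<longrightarrow> s = t) \<and>
     (\<forall>s. splitting A s \<longrightarrow> card (succs A s) = 2) \<and>
     (\<forall>i\<in>coded A. \<forall>s. splitting A s \<longrightarrow> len s \<noteq> len (code i))"

definition perfect :: "'r literal set set \<Rightarrow> bool" where
  "perfect A \<longleftrightarrow>
     (\<forall>t\<in>A. (\<exists>u\<in>A. t \<subset> u) \<and> (\<exists>u\<in>A. \<exists>u'\<in>A. t \<subseteq> u \<and> t \<subseteq> u' \<and> incomparable u u'))"


subsection \<open>Passing types and similarity\<close>

text \<open>\<open>passing t n A\<close> is \<open>t(c\<^sub>n; A)\<close>: the coding nodes of \<open>A\<close> preceding the first one of length at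
  least \<open>|c\<^sub>n|\<close> are those with index below \<open>n\<close>.\<close>

definition passing ::
    "'r literal set \<Rightarrow> nat \<Rightarrow> 'r literal set set \<Rightarrow> 'r literal set" where
  "passing t n A =
     {\<phi>\<in>entry t (len (code n)). lit_params \<phi> \<subseteq> insert n (coded A \<inter> {..<n})}"

definition passing_similar ::
    "'r literal set \<Rightarrow> nat \<Rightarrow> 'r literal set set \<Rightarrow>
     'r literal set \<Rightarrow> nat \<Rightarrow> 'r literal set set \<Rightarrow> bool" where
  "passing_similar s m A t n B \<longleftrightarrow>
     (\<exists>f. bij_betw f (coded A \<inter> {..<m}) (coded B \<inter> {..<n}) \<and>
        strict_mono_on (coded A \<inter> {..<m}) f \<and> f m = n \<and>
        (\<forall>R\<in>syms L. \<forall>zs. length zs = arity L R \<and> None \<in> set zs \<and>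
           set zs \<subseteq> insert None (Some ` insert m (coded A \<inter> {..<m})) \<longrightarrow>
           ((True, R, zs) \<in> passing s m A \<longleftrightarrow>
            (True, R, map (map_option f) zs) \<in> passing t n B)))"

definition similarity_map ::
    "'r literal set set \<Rightarrow> 'r literal set set \<Rightarrow>
     ('r literal set \<Rightarrow> 'r literal set) \<Rightarrow> bool" where
  "similarity_map S T f \<longleftrightarrow>
     meet_closed S \<and> meet_closed T \<and> bij_betw f S T \<and>
     (\<forall>s\<in>S. \<forall>t\<in>S.
        (prec ord s t \<longleftrightarrow> prec ord (f s) (f t)) \<and>
        (meet s t = {} \<longleftrightarrow> meet (f s) (f t) = {}) \<and>
        (meet s t \<noteq> {} \<longrightarrow> f (meet s t) = meet (f s) (f t)) \<and>
        (len s < len t \<longleftrightarrow> len (f s) < len (f t)) \<and>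
        (s \<subseteq> t \<longleftrightarrow> f s \<subseteq> f t)) \<and>
     (\<forall>n. has_idx S n \<longleftrightarrow> has_idx T n) \<and>
     (\<forall>n. has_idx S n \<longrightarrow>
        f (code (idx S n)) = code (idx T n) \<and>
        color (idx S n) = color (idx T n) \<and>
        (\<forall>s\<in>S. code_len S n < len s \<longrightarrow>
           passing_similar s (idx S n) S (f s) (idx T n) T))"

definition similar :: "'r literal set set \<Rightarrow> 'r literal set set \<Rightarrow> bool" where
  "similar S T \<longleftrightarrow> (\<exists>f. similarity_map S T f)"


subsection \<open>Diagonal coding subtrees\<close>

definition diagonal_coding_subtree :: "'r literal set set \<Rightarrow> bool" where
  "diagonal_coding_subtree T \<longleftrightarrow>
     subtree T \<and> diagonal T \<and>
     isomorphic L (induced M (coded T)) M \<and>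
     (\<forall>n. \<exists>h. bij_betw h
        ((\<lambda>t. type_restrict t (coded (down T (code_len T n)))) ` at_len T (Suc (code_len T n)))
        (level (Suc n))) \<and>
     (\<forall>m n. m < n \<and> code (idx T m) \<subseteq> code (idx T n) \<longrightarrow>
        (let A = down T (code_len T m - 1) in
           passing_similar (succ T (code (idx T n))) (idx T n) A
                           (succ T (code (idx T m))) (idx T m) A))"

definition perfect_diagonal_coding_subtree :: "'r literal set set \<Rightarrow> bool" where
  "perfect_diagonal_coding_subtree T \<longleftrightarrow> diagonal_coding_subtree T \<and> perfect T"

definition unaries_dense :: "'r literal set set \<Rightarrow> bool" where
  "unaries_dense T \<longleftrightarrow>
     (\<forall>t\<in>T. \<forall>R\<in>syms L. arity L R = 1 \<longrightarrow> (\<exists>i\<in>coded T. t \<subseteq> code i \<and> holds M R [i]))"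


subsection \<open>The Extension Property\<close>

definition similar_subtrees :: "'r literal set set \<Rightarrow> 'r literal set set set" where
  "similar_subtrees TT = {T. T \<subseteq> TT \<and> subtree T \<and> similar T TT}"

definition max_nodes :: "'r literal set set \<Rightarrow> 'r literal set set" where
  "max_nodes A = {s\<in>A. \<forall>t\<in>A. len t \<le> len s}"

text \<open>The successors of the empty tree are the minimal nodes of \<open>T\<close>.\<close>

definition max_succs :: "'r literal set set \<Rightarrow> 'r literal set set \<Rightarrow> 'r literal set set" where
  "max_succs T A = (if A = {} then at_len T 1 else \<Union>s\<in>max_nodes A. succs T s)"

text \<open>Lengths of the critical nodes of a subtree \<open>A\<close> of \<open>T\<close>.  The nodes in \<open>max(A)\<close> are
  terminal in \<open>A\<close>, so whether they count as splitting nodes is decided in \<open>T\<close>.\<close>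

definition critical_lens :: "'r literal set set \<Rightarrow> 'r literal set set \<Rightarrow> nat set" where
  "critical_lens T A =
     {len t | t. t \<in> A \<and> (splitting A t \<or> t \<in> max_nodes A \<and> splitting T t \<or> t \<in> range code)}"

definition initial ::
    "'r literal set set \<Rightarrow> nat \<Rightarrow> 'r literal set set \<Rightarrow> 'r literal set set" where
  "initial T k A =
     {t\<in>A. len t \<in> critical_lens T A \<and> card {l\<in>critical_lens T A. l < len t} < k}"

text \<open>If \<open>A\<close> is infinite then \<open>max_nodes A\<close> is empty, and \<open>plus_similar\<close> reduces to similarity.\<close>

definition plus_similar ::
    "'r literal set set \<Rightarrow> 'r literal set set \<Rightarrow> 'r literal set set \<Rightarrow> bool" where
  "plus_similar T A B \<longleftrightarrow>
     subtree A \<and> subtree B \<and> A \<subseteq> T \<and> B \<subseteq> T \<and>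
     (\<exists>f. similarity_map A B f \<and>
        (\<forall>u\<in>max_nodes A. splitting T u \<longrightarrow> f u \<in> max_nodes B \<and> splitting T (f u)) \<and>
        (\<forall>n. has_idx A n \<and> code (idx A n) \<in> max_nodes A \<longrightarrow>
           (\<forall>s\<in>max_nodes A.
              passing_similar (succ T s) (idx A n) A (succ T (f s)) (idx B n) B)))"

text \<open>\<open>s\<close> is the node of \<open>max(B)\<^sup>+\<close> that must be extended to a splitting node: it corresponds to
  the node of \<open>max(A)\<^sup>+\<close> below \<open>u\<close> under the unique order isomorphism of these two finite
  \<open>\<prec>\<close>-ordered level sets.  It is applied with \<open>initial T k A\<close> for \<open>A\<close>.\<close>

definition to_be_split ::
    "'r literal set set \<Rightarrow> 'r literal set set \<Rightarrow> 'r literal set \<Rightarrow>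
     'r literal set set \<Rightarrow> 'r literal set \<Rightarrow> bool" where
  "to_be_split T A u B s \<longleftrightarrow>
     (\<exists>h. bij_betw h (max_succs T A) (max_succs T B) \<and>
        (\<forall>x\<in>max_succs T A. \<forall>y\<in>max_succs T A. prec ord x y \<longleftrightarrow> prec ord (h x) (h y)) \<and>
        (\<exists>w\<in>max_succs T A. w \<subseteq> u \<and> s = h w))"

text \<open>The subtrees \<open>A\<close> are the unions of their restrictions \<open>r\<^sub>k(A)\<close>: a node of \<open>A\<close> strictly
  between two consecutive critical levels could not be copied when \<open>s'\<close> is chosen right above \<open>B\<close>.
  The inequation says that \<open>A\<close> has at least \<open>k + 1\<close> critical nodes.  The set \<open>X\<close> consists of \<open>s'\<close>
  and of the extensions of the remaining nodes.\<close>

definition EP :: "'r literal set set \<Rightarrow> bool" where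
  "EP TT \<longleftrightarrow>
     (\<forall>T\<in>similar_subtrees TT. \<forall>A k u B s s'.
        subtree A \<and> A \<subseteq> T \<and> A = (\<Union>j. initial T j A) \<and>
        initial T (Suc k) A \<noteq> initial T k A \<and>
        u \<in> max_nodes (initial T (Suc k) A) \<and> splitting T u \<and>
        plus_similar T (initial T k A) B \<and>
        to_be_split T (initial T k A) u B s \<and>
        splitting T s' \<and> s \<subseteq> s' \<longrightarrow>
        (\<exists>X A'. X \<subseteq> at_len T (len s') \<and> s' \<in> X \<and> (\<forall>x\<in>X. \<exists>t\<in>max_succs T B. t \<subseteq> x) \<and>
           plus_similar T (initial T (Suc k) A) (B \<union> X) \<and>
           plus_similar T A A' \<and> initial T (Suc k) A' = B \<union> X))"

end


section \<open>SDAP-plus and indivisibility\<close>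

definition diagonal_coding_tree_property ::
    "'r lang \<Rightarrow> ('r, nat) struct \<Rightarrow> bool" where
  "diagonal_coding_tree_property L K \<longleftrightarrow>
     (\<forall>M :: ('r, nat) struct. structure_for L M \<and> univ M = UNIV \<and> isomorphic L M K \<longrightarrow>
        (\<exists>T. coding_tree.perfect_diagonal_coding_subtree L L M T \<or>
             coding_tree.perfect_diagonal_coding_subtree L (non_unary L) M T))"

definition extension_property ::
    "'r lang \<Rightarrow> (bool \<times> 'r) rel \<Rightarrow> ('r, nat) struct \<Rightarrow> bool" where
  "extension_property L ord K \<longleftrightarrow>
     (\<exists>T. coding_tree.perfect_diagonal_coding_subtree L L K T \<and>
          coding_tree.EP L L ord K T) \<or>
     (\<nexists>T. coding_tree.perfect_diagonal_coding_subtree L L K T) \<and>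
     (\<exists>T. coding_tree.perfect_diagonal_coding_subtree L (non_unary L) K T \<and>
          coding_tree.unaries_dense L (non_unary L) K T \<and>
          coding_tree.EP L (non_unary L) ord K T)"

definition SDAP_plus :: "'r lang \<Rightarrow> (bool \<times> 'r) rel \<Rightarrow> ('r, nat) struct \<Rightarrow> bool" where
  "SDAP_plus L ord K \<longleftrightarrow>
     SDAP L (age L K) \<and> diagonal_coding_tree_property L K \<and> extension_property L ord K"

definition copies ::
    "'r lang \<Rightarrow> ('r, 'a) struct \<Rightarrow> ('r, 'a) struct \<Rightarrow> ('r, 'a) struct set" where
  "copies L A M = {N. substructure N M \<and> isomorphic L N A}"

definition indivisible :: "'r lang \<Rightarrow> ('r, 'a) struct \<Rightarrow> bool" where
  "indivisible L K \<longleftrightarrow>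
     (\<forall>A. substructure A K \<and> card (univ A) = 1 \<longrightarrow>
        (\<forall>(l::nat) (\<chi> :: ('r, 'a) struct \<Rightarrow> nat). l > 0 \<and> (\<forall>N\<in>copies L A K. \<chi> N < l) \<longrightarrow>
           (\<exists>K'. substructure K' K \<and> isomorphic L K' K \<and>
              (\<forall>N\<in>copies L A K'. \<forall>N'\<in>copies L A K'. \<chi> N = \<chi> N'))))"

end

theory Submission
  imports Defs
begin

text \<open>Disjoint amalgamation makes every type over a finite set infinitely often realized, so a back
  and forth argument shows that a set of vertices induces a copy of \<open>K\<close> as soon as it realizes every
  type over each of its finite subsets, and that copies survive the removal of finitely many
  vertices.  Split the vertices of a color \<open>\<gamma>\<close> into two parts, and look at the copy of \<open>K\<close> coded by
  the diagonal coding tree \<open>T\<close>.  Either discarding the second part of \<open>\<gamma>\<close> leaves a copy, or some type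
  over a finite set is realized in \<open>T\<close> only by vertices of the second part, and then so are all
  vertices of color \<open>\<gamma>\<close> in the cone above some coding node \<open>c\<close>.  In the latter case let \<open>u\<close> be the
  shortest splitting node of \<open>T\<close> with the same root as \<open>c\<close>.  The Extension Property, applied to \<open>u\<close> and
  to a splitting node \<open>s'\<close> above \<open>c\<close>, moves \<open>T\<close> to a similar tree in which all but finitely many coding
  nodes with that root lie above \<open>s'\<close>.  Similar trees code isomorphic structures, so this gives
  a copy of \<open>K\<close> all of whose vertices of color \<open>\<gamma>\<close> belong to the second part.\<close>

section \<open>Partial isomorphisms of an ultrahomogeneous structure\<close>

text \<open>A total function together with its intended domain stands for an isomorphism between two
  induced substructures; values outside \<open>X\<close> are irrelevant. In this form maps compose
  and restrict without mention of structures.\<close>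

definition partial_iso ::
    "'r lang \<Rightarrow> ('r, 'a) struct \<Rightarrow> ('a \<Rightarrow> 'a) \<Rightarrow> 'a set \<Rightarrow> bool" where
  "partial_iso L K f X \<longleftrightarrow> inj_on f X \<and>
     (\<forall>R\<in>syms L. \<forall>ts. length ts = arity L R \<and> set ts \<subseteq> X \<longrightarrow>
        (holds K R ts \<longleftrightarrow> holds K R (map f ts)))"

lemma partial_isoD:
  assumes "partial_iso L K f X"
  shows "inj_on f X"
    and "R \<in> syms L \<Longrightarrow> length ts = arity L R \<Longrightarrow> set ts \<subseteq> X \<Longrightarrow>
      holds K R (map f ts) \<longleftrightarrow> holds K R ts"
  using assms unfolding partial_iso_def by auto

lemma partial_iso_subset: "partial_iso L K f X \<Longrightarrow> Y \<subseteq> X \<Longrightarrow> partial_iso L K f Y"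
  unfolding partial_iso_def by (meson inj_on_subset subset_trans)

lemma partial_iso_cong:
  assumes "\<And>x. x \<in> X \<Longrightarrow> f x = g x"
  shows "partial_iso L K f X \<longleftrightarrow> partial_iso L K g X"
proof -
  have "inj_on f X \<longleftrightarrow> inj_on g X"
    using assms by (rule inj_on_cong)
  moreover have "map f ts = map g ts" if "set ts \<subseteq> X" for ts
    using assms that by auto
  ultimately show ?thesis
    unfolding partial_iso_def by metis
qed

lemma partial_iso_comp:
  assumes f: "partial_iso L K f X" and g: "partial_iso L K g (f ` X)"
  shows "partial_iso L K (g \<circ> f) X"
  unfolding partial_iso_def
proof (intro conjI ballI allI impI)
  show "inj_on (g \<circ> f) X"
    using partial_isoD(1)[OF f] partial_isoD(1)[OF g] by (rule comp_inj_on)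
next
  fix R ts assume *: "R \<in> syms L" "length ts = arity L R \<and> set ts \<subseteq> X"
  then have "holds K R (map g (map f ts)) \<longleftrightarrow> holds K R (map f ts)"
    by (intro partial_isoD(2)[OF g]) auto
  with * show "holds K R ts \<longleftrightarrow> holds K R (map (g \<circ> f) ts)"
    using partial_isoD(2)[OF f] by simp
qed

lemma partial_iso_inv_into:
  assumes f: "partial_iso L K f X"
  shows "partial_iso L K (inv_into X f) (f ` X)"
  unfolding partial_iso_def
proof (intro conjI ballI allI impI)
  show "inj_on (inv_into X f) (f ` X)"
    by (simp add: inj_on_inv_into)
next
  fix R ts assume *: "R \<in> syms L" "length ts = arity L R \<and> set ts \<subseteq> f ` X"
  let ?us = "map (inv_into X f) ts"
  have "map f ?us = ts"
    using * by (intro nth_equalityI) (auto simp: f_inv_into_f subset_iff)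
  moreover have "set ?us \<subseteq> X"
    using * by (auto intro: inv_into_into)
  ultimately show "holds K R ts \<longleftrightarrow> holds K R ?us"
    using partial_isoD(2)[OF f, of R ?us] * by simp
qed

section \<open>Isomorphisms between induced substructures\<close>

lemma univ_induced [simp]: "univ K = UNIV \<Longrightarrow> univ (induced K X) = X"
  by (simp add: induced_def)

lemma holds_induced [simp]:
  "univ K = UNIV \<Longrightarrow> holds (induced K X) R ts \<longleftrightarrow> holds K R ts \<and> set ts \<subseteq> X"
  by (simp add: induced_def)

lemma isomorphism_induced_iff:
  assumes "univ K = UNIV"
  shows "isomorphism L f (induced K X) (induced K Y) \<longleftrightarrow> partial_iso L K f X \<and> f ` X = Y"
  using assms unfolding isomorphism_def embedding_def partial_iso_def by (auto; blast)

lemma induced_UNIV: "structure_for L K \<Longrightarrow> univ K = UNIV \<Longrightarrow> induced K UNIV = K"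
  by (auto simp: induced_def)

lemma isomorphic_induced_UNIV_iff:
  assumes "structure_for L K" "univ K = UNIV"
  shows "isomorphic L (induced K X) K \<longleftrightarrow> (\<exists>f. partial_iso L K f X \<and> f ` X = UNIV)"
  using isomorphism_induced_iff[OF assms(2), of L _ X UNIV] induced_UNIV[OF assms]
  unfolding isomorphic_def by simp

text \<open>For \<open>x\<close> and \<open>y\<close> outside \<open>F\<close> this says that \<open>tp(x/F) = tp(y/F)\<close>.\<close>

definition same_type :: "'r lang \<Rightarrow> ('r, 'a) struct \<Rightarrow> 'a set \<Rightarrow> 'a \<Rightarrow> 'a \<Rightarrow> bool" where
  "same_type L K F x y \<longleftrightarrow> partial_iso L K (id(x := y)) (insert x F)"

text \<open>On \<open>insert x F\<close> such a map \<open>f\<close> agrees with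
  \<open>id(x := y)\<close>, so types can be compared through whichever map a construction
  yields.\<close>

lemma same_type_iff:
  assumes "x \<notin> F" "f x = y" "\<And>a. a \<in> F \<Longrightarrow> f a = a"
  shows "same_type L K F x y \<longleftrightarrow> partial_iso L K f (insert x F)"
  unfolding same_type_def by (rule partial_iso_cong) (use assms in auto)

lemma same_type_trans:
  assumes "x \<notin> F" "y \<notin> F" "same_type L K F x y" "same_type L K F y z"
  shows "same_type L K F x z"
proof -
  have "(id(x := y)) ` insert x F = insert y F"
    using assms(1) by auto
  then have "partial_iso L K (id(y := z) \<circ> id(x := y)) (insert x F)"
    using assms(3,4) by (intro partial_iso_comp) (auto simp: same_type_def)
  then show ?thesis
    by (subst same_type_iff) (use assms(1,2) in auto)
qed

lemma same_type_sym:
  assumes "x \<notin> F" "y \<notin> F" "same_type L K F x y"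
  shows "same_type L K F y x"
proof -
  let ?f = "id(x := y)"
  have f: "partial_iso L K ?f (insert x F)"
    using assms(3) by (simp add: same_type_def)
  have im: "?f ` insert x F = insert y F"
    using assms(1) by auto
  have *: "inv_into (insert x F) ?f b = a" if "a \<in> insert x F" "?f a = b" for a b
    using inv_into_f_f[OF partial_isoD(1)[OF f]] that by blast
  show ?thesis
  proof (subst same_type_iff)
    show "partial_iso L K (inv_into (insert x F) ?f) (insert y F)"
      using partial_iso_inv_into[OF f] im by simp
    show "inv_into (insert x F) ?f a = a" if "a \<in> F" for a
      using *[of a a] that assms(1) by (cases "a = x") auto
    show "inv_into (insert x F) ?f y = x"
      using *[of x y] by simp
  qed (fact assms(2))
qed


section \<open>Copies inside a Fraisse limit\<close>

locale fraisse_limit =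
  fixes L :: "'r lang" and K :: "('r, nat) struct"
  assumes is_structure: "structure_for L K"
    and univ_K: "univ K = UNIV"
    and homogeneous: "ultrahomogeneous L K"
    and disjoint_amalgamation: "disjoint_amalgamation_property L (age L K)"
begin

definition copy :: "nat set \<Rightarrow> bool" where
  "copy Y \<longleftrightarrow> isomorphic L (induced K Y) K"

lemma copy_iff: "copy Y \<longleftrightarrow> (\<exists>f. partial_iso L K f Y \<and> f ` Y = UNIV)"
  unfolding copy_def using is_structure univ_K by (rule isomorphic_induced_UNIV_iff)

text \<open>Inverting the isomorphism onto \<open>K\<close> gives a self-embedding of
  \<open>K\<close> with range \<open>Y\<close>, the form that is composed with further maps.\<close>

lemma copy_iff': "copy Y \<longleftrightarrow> (\<exists>f. partial_iso L K f UNIV \<and> range f = Y)"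
proof
  assume "copy Y"
  then obtain f where f: "partial_iso L K f Y" "f ` Y = UNIV"
    using copy_iff by blast
  moreover have "inv_into Y f ` UNIV = Y"
    using f partial_isoD(1)[OF f(1)] inv_into_image_cancel[of f Y Y] by simp
  ultimately show "\<exists>f. partial_iso L K f UNIV \<and> range f = Y"
    using partial_iso_inv_into[OF f(1)] by auto
next
  assume "\<exists>f. partial_iso L K f UNIV \<and> range f = Y"
  then obtain f where f: "partial_iso L K f UNIV" "range f = Y" by blast
  moreover have "inv_into UNIV f ` Y = UNIV"
    using f partial_isoD(1)[OF f(1)] by (metis inv_into_image_cancel order_refl)
  ultimately show "copy Y"
    using partial_iso_inv_into[OF f(1)] copy_iff by auto
qed

lemma copy_image:
  assumes "copy Y" "partial_iso L K f Y"
  shows "copy (f ` Y)"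
proof -
  obtain g where g: "partial_iso L K g UNIV" "range g = Y"
    using assms(1) copy_iff' by blast
  then have "partial_iso L K (f \<circ> g) UNIV"
    using assms(2) by (intro partial_iso_comp) auto
  moreover have "range (f \<circ> g) = f ` Y"
    using g(2) by (metis image_comp)
  ultimately show ?thesis
    using copy_iff' by blast
qed

section \<open>Ultrahomogeneity and realization of types\<close>

lemma extend_to_automorphism:
  assumes "finite X" "partial_iso L K f X"
  obtains g where "partial_iso L K g UNIV" "surj g" "\<And>x. x \<in> X \<Longrightarrow> g x = f x"
proof -
  have "isomorphism L f (induced K X) (induced K (f ` X))"
    using assms(2) isomorphism_induced_iff[OF univ_K] by blast
  then obtain g where g: "isomorphism L g K K" "\<forall>x\<in>X. g x = f x"
    using homogeneous assms(1) univ_K unfolding ultrahomogeneous_def by (metis subset_UNIV)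
  then have "partial_iso L K g UNIV \<and> range g = UNIV"
    using isomorphism_induced_iff[OF univ_K, of L g UNIV UNIV] induced_UNIV[OF is_structure univ_K]
    by simp
  then show ?thesis
    using that g(2) by blast
qed

lemma induced_in_age: "finite X \<Longrightarrow> induced K X \<in> age L K"
  using is_structure univ_K
  by (auto simp: age_def structure_for_def embedding_def intro!: exI[of _ id])

text \<open>Amalgamate \<open>insert v F\<close> and \<open>F \<union> G\<close> disjointly over
  \<open>F\<close> and embed the amalgam into \<open>K\<close>. By ultrahomogeneity the copy of
  \<open>F \<union> G\<close> can be moved back to its place; the image of \<open>v\<close> then
  misses \<open>G\<close> because the amalgamation is disjoint.\<close>

lemma type_realized_outside:
  assumes "finite F" "finite G" "v \<notin> F"
  obtains w where "w \<notin> F" "w \<notin> G" "same_type L K F w v"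
proof -
  let ?A = "induced K F" and ?B = "induced K (insert v F)" and ?C = "induced K (F \<union> G)"
  have "?A \<in> age L K" "?B \<in> age L K" "?C \<in> age L K"
    using assms induced_in_age by auto
  moreover have "embedding L id ?A ?B" "embedding L id ?A ?C"
    using univ_K by (auto simp: embedding_def)
  ultimately have "\<exists>D\<in>age L K. \<exists>r s. embedding L r ?B D \<and> embedding L s ?C D \<and>
      (\<forall>a\<in>univ ?A. r (id a) = s (id a)) \<and>
      r ` univ ?B \<inter> s ` univ ?C = r ` id ` univ ?A"
    using disjoint_amalgamation unfolding disjoint_amalgamation_property_def by blast
  then obtain D r s where D: "D \<in> age L K" "embedding L r ?B D" "embedding L s ?C D"
      "\<forall>a\<in>F. r a = s a" "r ` insert v F \<inter> s ` (F \<union> G) = r ` F"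
    using univ_K by auto
  obtain d where d: "embedding L d D K"
    using D(1) by (auto simp: age_def)
  have emb: "partial_iso L K (d \<circ> e) X" if e: "embedding L e (induced K X) D" for e X
    unfolding partial_iso_def
  proof (intro conjI ballI allI impI)
    have "inj_on e X" "e ` X \<subseteq> univ D"
      using e univ_K by (auto simp: embedding_def)
    then show "inj_on (d \<circ> e) X"
      using d by (auto simp: embedding_def intro: comp_inj_on inj_on_subset)
  next
    fix R ts assume *: "R \<in> syms L" "length ts = arity L R \<and> set ts \<subseteq> X"
    then have "holds K R ts \<longleftrightarrow> holds D R (map e ts)"
      using e univ_K by (auto simp: embedding_def)
    moreover have "set (map e ts) \<subseteq> univ D"
      using * e univ_K by (auto simp: embedding_def)
    then have "holds D R (map e ts) \<longleftrightarrow> holds K R (map d (map e ts))"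
      using d * unfolding embedding_def by (metis length_map)
    ultimately show "holds K R ts \<longleftrightarrow> holds K R (map (d \<circ> e) ts)"
      by simp
  qed
  have "finite (F \<union> G)"
    using assms by simp
  then obtain g where g: "partial_iso L K g UNIV" "surj g"
      "\<And>x. x \<in> F \<union> G \<Longrightarrow> g x = (d \<circ> s) x"
    using extend_to_automorphism emb[OF D(3)] by metis
  \<comment> \<open>The automorphism \<open>g\<close> extends the placement
    \<open>d \<circ> s\<close> of \<open>F \<union> G\<close>; undoing it returns \<open>F\<close>
    to itself, since \<open>r\<close> and \<open>s\<close> agree on \<open>F\<close>.\<close>
  define h where "h = inv_into UNIV g \<circ> (d \<circ> r)"
  have "partial_iso L K (inv_into UNIV g) UNIV"
    using partial_iso_inv_into[OF g(1)] g(2) by simp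
  then have h: "partial_iso L K h (insert v F)"
    unfolding h_def using emb[OF D(2)]
    by (blast intro: partial_iso_comp partial_iso_subset)
  have h_id: "h a = a" if "a \<in> F" for a
    using that D(4) g(3)[of a] partial_isoD(1)[OF g(1)] by (simp add: h_def inv_into_f_eq)
  have notin: "h v \<notin> F \<union> G"
  proof
    assume *: "h v \<in> F \<union> G"
    have "g (h v) = d (r v)"
      using g(2) by (simp add: h_def surj_f_inv_f)
    then have "d (s (h v)) = d (r v)"
      using g(3)[OF *] by simp
    moreover have "s (h v) \<in> univ D" "r v \<in> univ D"
      using * D(2,3) univ_K by (auto simp: embedding_def)
    ultimately have "s (h v) = r v"
      using d by (meson embedding_def inj_onD)
    then have "r v \<in> r ` F"
      using D(5) * by (metis IntI imageI insertI1)
    moreover have "inj_on r (insert v F)"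
      using D(2) univ_K by (simp add: embedding_def)
    ultimately show False
      using assms(3) by (auto simp: inj_on_def)
  qed
  have "same_type L K F v (h v)"
    by (subst same_type_iff) (use h h_id assms(3) in auto)
  then show ?thesis
    using that[of "h v"] same_type_sym[OF assms(3), of "h v" L K] notin by auto
qed

text \<open>The isomorphism \<open>f\<close> from \<open>Y\<close> onto \<open>K\<close> transports
  the question to \<open>K\<close>. There an automorphism \<open>g\<close> that agrees with
  \<open>f\<close> on \<open>F\<close> takes \<open>v\<close> to \<open>g v\<close>, and a
  realization of the type of \<open>g v\<close> over the image of \<open>F\<close> is pulled back
  along \<open>f\<close>. Avoiding the image of \<open>G \<inter> Y\<close> keeps it out of
  \<open>G\<close>.\<close>

lemma copy_realizes_types:
  assumes Y: "copy Y" and F: "finite F" "F \<subseteq> Y" and G: "finite G" and v: "v \<notin> F"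
  obtains y where "y \<in> Y" "y \<notin> F" "y \<notin> G" "same_type L K F y v"
proof -
  obtain f where f: "partial_iso L K f Y" "f ` Y = UNIV"
    using Y copy_iff by blast
  obtain g where g: "partial_iso L K g UNIV" "surj g" "\<And>x. x \<in> F \<Longrightarrow> g x = f x"
    using extend_to_automorphism[OF F(1) partial_iso_subset[OF f(1) F(2)]] by metis
  have gv: "g v \<notin> f ` F"
    using v g(3) partial_isoD(1)[OF g(1)] by (metis imageE inj_eq)
  obtain w where w: "w \<notin> f ` F" "w \<notin> f ` (G \<inter> Y)" "same_type L K (f ` F) w (g v)"
    using type_realized_outside[OF _ _ gv, of "f ` (G \<inter> Y)"] F(1) G by blast
  obtain y where y: "y \<in> Y" "f y = w"
    using f(2) by (metis UNIV_I imageE)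
  have yF: "y \<notin> F" "y \<notin> G"
    using w y by auto
  \<comment> \<open>This map takes \<open>y\<close> to \<open>w\<close>, then to \<open>g v\<close>
    and back to \<open>v\<close>; it fixes \<open>F\<close> because \<open>f\<close> and
    \<open>g\<close> agree there.\<close>
  define h where "h = inv_into UNIV g \<circ> (id(w := g v) \<circ> f)"
  have "partial_iso L K f (insert y F)"
    using f(1) F(2) y(1) by (auto intro: partial_iso_subset)
  moreover have "partial_iso L K (id(w := g v)) (f ` insert y F)"
    using w(3) y(2) by (simp add: same_type_def)
  moreover have "partial_iso L K (inv_into UNIV g) UNIV"
    using partial_iso_inv_into[OF g(1)] g(2) by simp
  ultimately have h: "partial_iso L K h (insert y F)"
    unfolding h_def by (blast intro: partial_iso_comp partial_iso_subset)
  have "h y = v"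
    using y(2) partial_isoD(1)[OF g(1)] by (simp add: h_def)
  moreover have "h a = a" if "a \<in> F" for a
  proof -
    have "f a \<noteq> w"
      using w(1) that by auto
    then show ?thesis
      using g(3)[OF that] partial_isoD(1)[OF g(1)] by (simp add: h_def inv_into_f_eq)
  qed
  ultimately have "same_type L K F y v"
    by (subst same_type_iff) (use h yF in auto)
  then show ?thesis
    using that y(1) yF by blast
qed

text \<open>The two halves of a back and forth step, both from an automorphism \<open>g\<close>
  extending \<open>f\<close>. To enlarge the domain, restrict \<open>g\<close>. To reach
  \<open>v\<close>, take its preimage \<open>w\<close> under \<open>g\<close> and, if
  \<open>w\<close> is not in \<open>X\<close>, replace it by an element of \<open>Y\<close> with the
  same type over \<open>X\<close>.\<close>

lemma partial_iso_insert:
  assumes Y: "\<And>F v. finite F \<Longrightarrow> F \<subseteq> Y \<Longrightarrow> v \<notin> F \<Longrightarrow>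
      \<exists>y\<in>Y. y \<notin> F \<and> same_type L K F y v"
    and X: "finite X" "X \<subseteq> Y" "partial_iso L K f X"
  shows "y \<in> Y \<Longrightarrow> \<exists>g. (\<forall>x\<in>X. g x = f x) \<and> partial_iso L K g (insert y X)"
    and "\<exists>y\<in>Y. \<exists>g. (\<forall>x\<in>X. g x = f x) \<and> partial_iso L K g (insert y X) \<and> g y = v"
proof -
  obtain g where g: "partial_iso L K g UNIV" "surj g" "\<And>x. x \<in> X \<Longrightarrow> g x = f x"
    using extend_to_automorphism[OF X(1,3)] by blast
  show "y \<in> Y \<Longrightarrow> \<exists>g. (\<forall>x\<in>X. g x = f x) \<and> partial_iso L K g (insert y X)"
    using g by (meson partial_iso_subset subset_UNIV)
  obtain w where w: "g w = v"
    using g(2) by (metis surjD)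
  show "\<exists>y\<in>Y. \<exists>g. (\<forall>x\<in>X. g x = f x) \<and> partial_iso L K g (insert y X) \<and> g y = v"
  proof (cases "w \<in> X")
    case True
    then show ?thesis
      using g(3) w X by (metis insert_absorb subsetD)
  next
    case False
    then obtain y where y: "y \<in> Y" "y \<notin> X" "same_type L K X y w"
      using Y X by blast
    have "partial_iso L K (g \<circ> id(y := w)) (insert y X)"
      using y(3) g(1)
      by (auto simp: same_type_def intro!: partial_iso_comp intro: partial_iso_subset)
    moreover have "\<forall>x\<in>X. (g \<circ> id(y := w)) x = f x"
      using y(2) g(3) by auto
    moreover have "(g \<circ> id(y := w)) y = v"
      using w by simp
    ultimately show ?thesis
      using y(1) by blast
  qed
qed

text \<open>Back and forth along the natural numbers: stage \<open>n\<close> puts \<open>n\<close>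
  into the range and, if it belongs to \<open>Y\<close>, into the domain. The union of the finite
  maps is an isomorphism onto \<open>K\<close>.\<close>

lemma copyI:
  assumes Y: "\<And>F v. finite F \<Longrightarrow> F \<subseteq> Y \<Longrightarrow> v \<notin> F \<Longrightarrow>
      \<exists>y\<in>Y. y \<notin> F \<and> same_type L K F y v"
  shows "copy Y"
proof -
  define P where "P = (\<lambda>(X, f). finite X \<and> X \<subseteq> Y \<and> partial_iso L K f X)"
  define Q where "Q = (\<lambda>n (X, f) (X', f').
    X \<subseteq> X' \<and> (\<forall>x\<in>X. f' x = f x) \<and> (n \<in> Y \<longrightarrow> n \<in> X') \<and> n \<in> f' ` X')"
  have ex: "\<exists>b. P b \<and> Q n a b" if a: "P a" for n a
  proof -
    obtain X f where Xf: "a = (X, f)" by fastforce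
    have X: "finite X" "X \<subseteq> Y" "partial_iso L K f X"
      using a Xf by (auto simp: P_def)
    obtain X1 f1 where X1: "finite X1" "X1 \<subseteq> Y" "partial_iso L K f1 X1" "X \<subseteq> X1"
        "\<forall>x\<in>X. f1 x = f x" "n \<in> Y \<longrightarrow> n \<in> X1"
    proof (cases "n \<in> Y")
      case True
      then obtain g where "\<forall>x\<in>X. g x = f x" "partial_iso L K g (insert n X)"
        using partial_iso_insert(1)[OF Y X] by blast
      then show ?thesis
        using that[of "insert n X" g] X True by auto
    qed (use that[of X f] X in auto)
    obtain y g where y: "y \<in> Y" "\<forall>x\<in>X1. g x = f1 x" "partial_iso L K g (insert y X1)" "g y = n"
      using partial_iso_insert(2)[OF Y X1(1-3)] by blast
    have "P (insert y X1, g)"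
      using y X1 by (auto simp: P_def)
    moreover have "Q n a (insert y X1, g)"
      using y X1 Xf by (auto simp: Q_def)
    ultimately show ?thesis by blast
  qed
  have "P ({}, id)"
    by (auto simp: P_def partial_iso_def)
  then have "\<exists>c. \<forall>n. P (c n) \<and> Q n (c n) (c (Suc n))"
    by (intro dependent_nat_choice ex) auto
  then obtain c where c: "\<And>n. P (c n)" "\<And>n. Q n (c n) (c (Suc n))"
    by blast
  define X where "X n = fst (c n)" for n
  define f where "f n = snd (c n)" for n
  have c_eq: "c n = (X n, f n)" for n
    by (simp add: X_def f_def)
  have X: "X n \<subseteq> Y" "partial_iso L K (f n) (X n)" for n
    using c(1)[of n] by (auto simp: P_def c_eq)
  have step: "X n \<subseteq> X (Suc n)" "\<And>x. x \<in> X n \<Longrightarrow> f (Suc n) x = f n x"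
      "n \<in> Y \<Longrightarrow> n \<in> X (Suc n)" "n \<in> f (Suc n) ` X (Suc n)" for n
    using c(2)[of n] by (auto simp: Q_def c_eq)
  have X_mono: "X m \<subseteq> X n" if "m \<le> n" for m n
    using step(1) that by (rule lift_Suc_mono_le)
  have f_mono: "f n x = f m x" if "m \<le> n" "x \<in> X m" for m n x
    using that(1)
  proof (induction n rule: dec_induct)
    case (step n)
    then show ?case
      using \<open>x \<in> X m\<close> X_mono[of m n] \<open>\<And>x n. x \<in> X n \<Longrightarrow> f (Suc n) x = f n x\<close> by auto
  qed simp
  \<comment> \<open>An element \<open>y\<close> of \<open>Y\<close> is in the domain by stage
    \<open>Suc y\<close>, and a value once assigned never changes.\<close>
  define g where "g y = f (Suc y) y" for y
  have g_eq: "g y = f n y" if "y \<in> X n" for y n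
  proof -
    have "y \<in> X (Suc y)"
      using that X(1) step(3) by blast
    then show ?thesis
      using that f_mono unfolding g_def by (metis nat_le_linear)
  qed
  have g_iso: "partial_iso L K g (X n)" for n
    using X(2) g_eq partial_iso_cong by metis
  have "partial_iso L K g Y"
    unfolding partial_iso_def
  proof (intro conjI ballI allI impI)
    show "inj_on g Y"
    proof (rule inj_onI)
      fix x y assume "x \<in> Y" "y \<in> Y" "g x = g y"
      moreover have "x \<in> X (max (Suc x) (Suc y))" "y \<in> X (max (Suc x) (Suc y))"
        using step(3)[OF \<open>x \<in> Y\<close>] step(3)[OF \<open>y \<in> Y\<close>] X_mono
        by (meson max.cobounded1 max.cobounded2 subsetD)+
      ultimately show "x = y"
        using partial_isoD(1)[OF g_iso] by (metis inj_onD)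
    qed
  next
    fix R ts assume *: "R \<in> syms L" "length ts = arity L R \<and> set ts \<subseteq> Y"
    have "x \<in> X (Suc (Max (set ts)))" if "x \<in> set ts" for x
    proof -
      have "x \<in> X (Suc x)"
        using that * step(3) by blast
      moreover have "Suc x \<le> Suc (Max (set ts))"
        using that by simp
      ultimately show ?thesis
        using X_mono by blast
    qed
    then show "holds K R ts \<longleftrightarrow> holds K R (map g ts)"
      using partial_isoD(2)[OF g_iso] * by (metis subsetI)
  qed
  moreover have "g ` Y = UNIV"
  proof -
    have "n \<in> g ` Y" for n
    proof -
      obtain y where y: "y \<in> X (Suc n)" "n = f (Suc n) y"
        using step(4)[of n] by blast
      then have "n = g y"
        using g_eq by simp
      then show ?thesis
        using y(1) X(1) by blast
    qed
    then show ?thesis by blast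
  qed
  ultimately show ?thesis
    using copy_iff by blast
qed

text \<open>Realizations of a type can be found outside any finite set, so \<open>G\<close> can
  always be avoided.\<close>

lemma copy_diff_finite:
  assumes "copy Y" "finite G"
  shows "copy (Y - G)"
proof (rule copyI)
  fix F v assume "finite F" "F \<subseteq> Y - G" "v \<notin> F"
  then show "\<exists>y\<in>Y - G. y \<notin> F \<and> same_type L K F y v"
    using copy_realizes_types[OF assms(1), of F G v] assms(2) by blast
qed

lemma copy_infinite: "copy Y \<Longrightarrow> infinite Y"
  using copy_iff finite_imageI infinite_UNIV_nat by metis

end


section \<open>Nodes, segments and meets\<close>

lemma finite_lit_params: "finite (lit_params \<phi>)"
proof (rule finite_subset)
  show "lit_params \<phi> \<subseteq> the ` set (snd (snd \<phi>))"
    by (force simp: lit_params_def)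
qed simp

lemma lit_params_subset_iff:
  "lit_params (b, R, zs) \<subseteq> P \<longleftrightarrow> set zs \<subseteq> insert None (Some ` P)"
  unfolding lit_params_def by (auto simp: subset_iff image_iff) (metis option.exhaust)

lemma seg_0 [simp]: "seg s 0 = {}"
  by (simp add: seg_def)

text \<open>The largest parameter of a literal decides its entry, with a shift by one because entry
  \<open>0\<close> holds the parameter-free literals.\<close>

lemma seg_Suc: "seg s (Suc m) = type_restrict s {..<m}"
proof (intro set_eqI iffI)
  fix \<phi> assume "\<phi> \<in> seg s (Suc m)"
  then obtain k where k: "k \<le> m" "\<phi> \<in> entry s k"
    by (auto simp: seg_def less_Suc_eq_le)
  then show "\<phi> \<in> type_restrict s {..<m}"
    by (cases k) (auto simp: type_restrict_def)
next
  fix \<phi> assume "\<phi> \<in> type_restrict s {..<m}"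
  then have \<phi>: "\<phi> \<in> s" "lit_params \<phi> \<subseteq> {..<m}"
    by (auto simp: type_restrict_def)
  show "\<phi> \<in> seg s (Suc m)"
  proof (cases "lit_params \<phi> = {}")
    case True
    then have "\<phi> \<in> entry s 0"
      using \<phi> by simp
    then show ?thesis
      unfolding seg_def by blast
  next
    case False
    let ?j = "Max (lit_params \<phi>)"
    have j: "?j \<in> lit_params \<phi>"
      using Max_in[OF finite_lit_params False] .
    then have "\<phi> \<in> entry s (Suc ?j)"
      using \<phi>(1) Max_ge[OF finite_lit_params[of \<phi>]] by auto
    moreover have "Suc ?j < Suc m"
      using j \<phi>(2) by auto
    ultimately show ?thesis
      unfolding seg_def by blast
  qed
qed

lemma seg_subset: "seg s l \<subseteq> s"
  by (cases l) (auto simp: seg_Suc type_restrict_def)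

lemma seg_seg: "l \<le> m \<Longrightarrow> seg (seg s m) l = seg s l"
  by (cases l; cases m) (auto simp: seg_Suc type_restrict_def)

lemma seg_eq_mono: "seg s m = seg t m \<Longrightarrow> l \<le> m \<Longrightarrow> seg s l = seg t l"
  by (metis seg_seg)

lemma tp_restrict: "type_restrict (tp L M i P) Q = tp L M i (P \<inter> Q)"
proof -
  have "set zs \<subseteq> insert None (Some ` (P \<inter> Q)) \<longleftrightarrow>
      set zs \<subseteq> insert None (Some ` P) \<and> set zs \<subseteq> insert None (Some ` Q)" for zs
    by auto
  then have "\<phi> \<in> type_restrict (tp L M i P) Q \<longleftrightarrow> \<phi> \<in> tp L M i (P \<inter> Q)" for \<phi>
    by (cases \<phi>) (simp add: type_restrict_def tp_def lit_params_subset_iff conj_ac)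
  then show ?thesis by blast
qed

lemma meet_len:
  shows "meet_len s t \<le> len s" "meet_len s t \<le> len t"
    and "seg s (meet_len s t) = seg t (meet_len s t)"
proof -
  let ?P = "\<lambda>l. l \<le> len s \<and> l \<le> len t \<and> seg s l = seg t l"
  \<comment> \<open>The length \<open>0\<close> always qualifies and \<open>len s\<close> is a
    bound, so the greatest value exists.\<close>
  have "?P (meet_len s t)"
    unfolding meet_len_def by (rule GreatestI_nat[where k = 0 and b = "len s"]) auto
  then show "meet_len s t \<le> len s" "meet_len s t \<le> len t"
    "seg s (meet_len s t) = seg t (meet_len s t)" by auto
qed

lemma meet_len_ge:
  "l \<le> len s \<Longrightarrow> l \<le> len t \<Longrightarrow> seg s l = seg t l \<Longrightarrow> l \<le> meet_len s t"
  unfolding meet_len_def by (rule Greatest_le_nat[where b = "len s"]) auto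

lemma meet_commute: "meet s t = meet t s"
  unfolding meet_def by (metis antisym meet_len meet_len_ge)

text \<open>At the least point of disagreement the smaller value is also taken by the other map,
  necessarily at an earlier point, where both maps agree; this contradicts strict monotonicity. It
  serves to identify the bijections hidden in \<open>passing_similar\<close>.\<close>

lemma strict_mono_on_image_unique:
  fixes X :: "nat set" and f g :: "nat \<Rightarrow> nat"
  assumes "strict_mono_on X f" "strict_mono_on X g" "f ` X = g ` X" "x \<in> X"
  shows "f x = g x"
  using assms(4)
proof (induction x rule: less_induct)
  case (less x)
  have *: "\<not> p x < q x" if p: "strict_mono_on X p" and q: "strict_mono_on X q"
    and im: "p ` X = q ` X" and eq: "\<And>y. y < x \<Longrightarrow> y \<in> X \<Longrightarrow> p y = q y" for p q :: "nat \<Rightarrow> nat"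
  proof
    assume lt: "p x < q x"
    obtain y where y: "y \<in> X" "p x = q y"
      using im less.prems by blast
    then have "y < x"
      using lt q less.prems by (metis not_less_iff_gr_or_eq strict_mono_onD)
    then show False
      using eq y p less.prems by (metis less_irrefl strict_mono_onD)
  qed
  show ?case
    using *[OF assms(1,2)] *[OF assms(2,1)] assms(3) less.IH by (metis linorder_neqE_nat)
qed


text \<open>The assumptions on \<open>LT\<close> are what \<open>L\<close> and \<^term>\<open>non_unary L\<close> have in common.\<close>

locale conventional_coding_tree = coding_tree L LT ord M
  for L LT :: "'r lang" and ord :: "(bool \<times> 'r) rel" and M :: "('r, nat) struct" +
  assumes univ_M: "univ M = UNIV"
    and holds_distinct: "holds M R ts \<Longrightarrow> distinct ts"
    and arity_pos: "R \<in> syms L \<Longrightarrow> arity L R \<ge> 1"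
    and arity_LT: "arity LT = arity L"
    and syms_LT_subset: "syms LT \<subseteq> syms L"
    and non_unary_syms_LT: "R \<in> syms L \<Longrightarrow> arity L R > 1 \<Longrightarrow> R \<in> syms LT"
    and ex_non_unary: "\<exists>R\<in>syms L. arity L R > 1"
begin

section \<open>Nodes as complete types\<close>

abbreviation node :: "nat \<Rightarrow> nat \<Rightarrow> 'r literal set" where
  "node i n \<equiv> tp LT M i {..<n}"

lemma in_tree_iff: "s \<in> tree \<longleftrightarrow> (\<exists>i n. n \<le> i \<and> s = node i n)"
  by (auto simp: tree_def level_def)

lemma seg_node: "seg (node i n) (Suc m) = node i (min n m)"
proof -
  have "{..<n} \<inter> {..<m} = {..<min n m}" by auto
  then show ?thesis
    by (simp add: seg_Suc tp_restrict)
qed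

lemma params_node: "params (node i n) = {..<n}"
proof
  show "params (node i n) \<subseteq> {..<n}"
    by (auto simp: params_def tp_def lit_params_def)
  show "{..<n} \<subseteq> params (node i n)"
  proof
    fix a assume a: "a \<in> {..<n}"
    obtain R where R: "R \<in> syms LT" "arity LT R > 1"
      using ex_non_unary non_unary_syms_LT arity_LT by auto
    \<comment> \<open>Arity above one leaves room for both \<open>x\<close> and \<open>a\<close>.
      Whether the relation holds of this tuple or fails, one of the two literals is in the
      type.\<close>
    define zs where "zs = None # replicate (arity LT R - 1) (Some a)"
    have "(holds M R (map (\<lambda>z. case z of None \<Rightarrow> i | Some a \<Rightarrow> a) zs), R, zs) \<in> node i n"
      using R a by (auto simp: tp_def zs_def)
    moreover have "Some a \<in> set zs"
      using R(2) by (simp add: zs_def)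
    ultimately show "a \<in> params (node i n)"
      unfolding params_def lit_params_def by force
  qed
qed

lemma len_node: "len (node i n) = Suc n"
proof -
  obtain R where R: "R \<in> syms LT"
    using ex_non_unary non_unary_syms_LT by auto
  then have "(holds M R (replicate (arity LT R) i), R, replicate (arity LT R) None) \<in> node i n"
    using arity_pos[of R] syms_LT_subset arity_LT by (auto simp: tp_def)
  then have "node i n \<noteq> {}" by blast
  then show ?thesis
    by (simp add: len_def params_node)
qed

lemma len_empty [simp]: "len {} = 0"
  by (simp add: len_def)

lemma tree_len_pos: "s \<in> tree \<Longrightarrow> 1 \<le> len s"
  by (auto simp: in_tree_iff len_node)

lemma len_seg: "s \<in> tree \<Longrightarrow> l \<le> len s \<Longrightarrow> len (seg s l) = l"
  by (cases l) (auto simp: in_tree_iff len_node seg_node min_def)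

lemma seg_eq_self: "s \<in> tree \<Longrightarrow> len s \<le> l \<Longrightarrow> seg s l = s"
  by (cases l) (auto simp: in_tree_iff len_node seg_node min_def)

lemma seg_in_tree:
  assumes "s \<in> tree" "1 \<le> l" "l \<le> len s"
  shows "seg s l \<in> tree"
proof -
  obtain i n where "n \<le> i" "s = node i n"
    using assms(1) in_tree_iff by blast
  moreover from this obtain m where "l = Suc m" "m \<le> n"
    using assms(2,3) by (cases l) (auto simp: len_node)
  ultimately have "m \<le> i" "seg s l = node i m"
    by (auto simp: seg_node min_def)
  then show ?thesis
    using in_tree_iff by blast
qed

text \<open>Types are complete: over the same parameters each literal or its negation is present, so
  inclusion already forces equality.\<close>

lemma node_subset: "node i n \<subseteq> node j m \<Longrightarrow> n \<le> m \<and> node i n = node j n"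
proof
  assume sub: "node i n \<subseteq> node j m"
  then have "params (node i n) \<subseteq> params (node j m)"
    by (auto simp: params_def)
  then show nm: "n \<le> m"
    by (simp add: params_node)
  show "node i n = node j n"
  proof
    show "node i n \<subseteq> node j n"
      using sub nm by (auto simp: tp_def)
    show "node j n \<subseteq> node i n"
    proof
      fix \<phi> assume \<phi>: "\<phi> \<in> node j n"
      obtain b R zs where e: "\<phi> = (b, R, zs)" by (cases \<phi>)
      define b' where "b' = holds M R (map (\<lambda>z. case z of None \<Rightarrow> i | Some a \<Rightarrow> a) zs)"
      have b': "(b', R, zs) \<in> node i n"
        using \<phi> e by (auto simp: tp_def b'_def)
      then have "(b', R, zs) \<in> node j m"
        using sub by blast
      then have "b = b'"
        using \<phi> e by (auto simp: tp_def)
      then show "\<phi> \<in> node i n"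
        using b' e by simp
    qed
  qed
qed

text \<open>Nodes are stored as sets of literals; this matches inclusion with the initial segment
  order of the sequences they stand for.\<close>

lemma subset_iff_seg:
  assumes "s \<in> tree" "t \<in> tree"
  shows "s \<subseteq> t \<longleftrightarrow> len s \<le> len t \<and> seg t (len s) = s"
proof
  assume sub: "s \<subseteq> t"
  obtain i n j m where "s = node i n" "t = node j m"
    using assms in_tree_iff by metis
  then show "len s \<le> len t \<and> seg t (len s) = s"
    using sub node_subset[of i n j m] by (simp add: len_node seg_node min_absorb2)
next
  assume "len s \<le> len t \<and> seg t (len s) = s"
  then show "s \<subseteq> t"
    using seg_subset by metis
qed

lemma len_code: "len (code i) = Suc i"
  by (simp add: code_def len_node)

section \<open>Meets and splitting nodes\<close>

lemma incomparable_meet_len: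
  assumes "s \<in> tree" "t \<in> tree" "incomparable s t"
  shows "meet_len s t < len s" "meet_len s t < len t"
    and "seg s (Suc (meet_len s t)) \<noteq> seg t (Suc (meet_len s t))"
proof -
  show "meet_len s t < len s"
    using assms meet_len[of s t] seg_eq_self[OF assms(1), of "len s"]
    by (metis incomparable_def le_neq_implies_less subset_iff_seg)
  moreover show "meet_len s t < len t"
    using assms meet_len[of s t] seg_eq_self[OF assms(2), of "len t"]
    by (metis incomparable_def le_neq_implies_less subset_iff_seg)
  ultimately show "seg s (Suc (meet_len s t)) \<noteq> seg t (Suc (meet_len s t))"
    using meet_len_ge[of "Suc (meet_len s t)" s t] by auto
qed

lemma len_meet: "s \<in> tree \<Longrightarrow> len (meet s t) = meet_len s t"
  unfolding meet_def using len_seg meet_len(1) by blast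

lemma meet_subset_eq:
  assumes "s \<in> tree" "t \<in> tree" "s \<subseteq> t"
  shows "meet s t = s"
proof -
  have "len s \<le> meet_len s t"
    using assms subset_iff_seg seg_eq_self by (intro meet_len_ge) auto
  then show ?thesis
    unfolding meet_def using seg_eq_self[OF assms(1)] by blast
qed

text \<open>The parameter-free part \<open>seg s 1\<close> is the root of \<open>s\<close>. The tree
  may have several roots, and two nodes meet in a proper node when they share one.\<close>

lemma meet_nonempty:
  assumes "s \<in> tree" "t \<in> tree" "seg s 1 = seg t 1"
  shows "meet s t \<noteq> {}" "seg (meet s t) 1 = seg s 1"
proof -
  have "1 \<le> meet_len s t"
    using assms tree_len_pos by (intro meet_len_ge) auto
  moreover from this show "seg (meet s t) 1 = seg s 1"
    unfolding meet_def by (rule seg_seg)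
  ultimately show "meet s t \<noteq> {}"
    using len_meet[OF assms(1), of t] by auto
qed

lemma incomparable_meet:
  assumes "s \<in> tree" "t \<in> tree" "incomparable s t"
  shows "len (meet s t) < len s" "len (meet s t) < len t"
    "seg s (Suc (len (meet s t))) \<noteq> seg t (Suc (len (meet s t)))"
  using incomparable_meet_len[OF assms] len_meet[OF assms(1)] by simp_all

lemma hat_subset_tree: "T \<subseteq> tree \<Longrightarrow> hat T \<subseteq> tree"
  by (auto simp: hat_def intro: seg_in_tree)

text \<open>The two nodes part just above their meet, so their segments of the next length are
  distinct successors in \<open>hat T\<close>.\<close>

lemma splitting_meet:
  assumes "T \<subseteq> tree" "s \<in> T" "t \<in> T" "incomparable s t" "meet s t \<noteq> {}"
  shows "splitting T (meet s t)"
proof -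
  let ?m = "len (meet s t)"
  have tree: "s \<in> tree" "t \<in> tree"
    using assms by auto
  note inc = incomparable_meet[OF tree assms(4)]
  have m: "?m = meet_len s t"
    using len_meet tree by blast
  have eq: "meet s t = seg s ?m" "meet s t = seg t ?m"
    using meet_len(3)[of s t] m by (auto simp: meet_def)
  have "?m \<noteq> 0"
    using eq assms(5) by (metis seg_0)
  then have "meet s t \<in> hat T"
    using eq(1) inc(1) assms(2) unfolding hat_def
    by (metis (mono_tags, lifting) One_nat_def Suc_leI less_imp_le_nat mem_Collect_eq neq0_conv)
  moreover have "seg x (Suc ?m) \<in> succs T (meet s t)"
    if "x \<in> T" "?m < len x" "meet s t = seg x ?m" for x
  proof -
    have x: "x \<in> tree"
      using that(1) assms(1) by blast
    have "seg x (Suc ?m) \<in> hat T"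
      unfolding hat_def using that by force
    moreover have "meet s t \<subseteq> seg x (Suc ?m)"
      using seg_subset[of "seg x (Suc ?m)" ?m] seg_seg[of ?m "Suc ?m" x] that(3) by simp
    ultimately show ?thesis
      using that len_seg[OF x] by (auto simp: succs_def)
  qed
  ultimately show ?thesis
    unfolding splitting_def using inc eq assms(2,3) by blast
qed

text \<open>Converse of \<open>splitting_meet\<close>: successors are taken in \<open>hat T\<close>,
  so two of them are segments of nodes of \<open>T\<close>, and these nodes meet in
  \<open>s\<close>.\<close>

lemma splitting_is_meet:
  assumes T: "T \<subseteq> tree" and s: "splitting T s"
  obtains x y where "x \<in> T" "y \<in> T" "incomparable x y" "meet x y = s"
proof -
  obtain a b where ab: "a \<in> succs T s" "b \<in> succs T s" "a \<noteq> b" and hat: "s \<in> hat T"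
    using s unfolding splitting_def by blast
  have s_tree: "s \<in> tree"
    using hat T hat_subset_tree by blast
  have *: "\<exists>x\<in>T. Suc (len s) \<le> len x \<and> a = seg x (Suc (len s)) \<and> s = seg x (len s)"
    if a: "a \<in> succs T s" for a
  proof -
    obtain x n where x: "a = seg x n" "x \<in> T" "1 \<le> n" "n \<le> len x"
      using a by (auto simp: succs_def hat_def)
    have n: "n = Suc (len s)"
      using a x T len_seg by (auto simp: succs_def)
    have "a \<in> tree"
      using a T hat_subset_tree by (auto simp: succs_def)
    then have "seg a (len s) = s"
      using a s_tree subset_iff_seg by (auto simp: succs_def)
    then show ?thesis
      using x n seg_seg[of "len s" n x] by auto
  qed
  obtain x y where x: "x \<in> T" "Suc (len s) \<le> len x" "a = seg x (Suc (len s))" "s = seg x (len s)"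
    and y: "y \<in> T" "Suc (len s) \<le> len y" "b = seg y (Suc (len s))" "s = seg y (len s)"
    using *[OF ab(1)] *[OF ab(2)] by blast
  have tree: "x \<in> tree" "y \<in> tree"
    using x y T by auto
  have neq: "seg x (Suc (len s)) \<noteq> seg y (Suc (len s))"
    using x y ab by simp
  have "\<not> u \<subseteq> v" if "u \<in> tree" "v \<in> tree" "Suc (len s) \<le> len u"
    "seg u (Suc (len s)) \<noteq> seg v (Suc (len s))" for u v
    using that subset_iff_seg seg_seg by metis
  then have "incomparable x y"
    using x y neq tree unfolding incomparable_def by metis
  moreover have "meet_len x y = len s"
  proof (rule antisym)
    show "len s \<le> meet_len x y"
      using x y by (intro meet_len_ge) auto
    show "meet_len x y \<le> len s"
      using neq meet_len(3)[of x y] seg_eq_mono not_less_eq_eq by blast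
  qed
  then have "meet x y = s"
    using x by (simp add: meet_def)
  ultimately show ?thesis
    using that x y by blast
qed


section \<open>Similar trees code isomorphic structures\<close>

lemma code_in_tree: "code i \<in> tree"
  unfolding in_tree_iff code_def by blast

lemma seg_code_1: "seg (code i) 1 = tp LT M i {}"
  using seg_node[of i i 0] by (simp add: code_def)

text \<open>The root of \<open>code i\<close> is the part of the color that concerns symbols of
  \<open>LT\<close>; for \<open>LT = non_unary L\<close> the unary symbols drop out.\<close>

lemma color_eq_imp_seg_eq:
  assumes "color i = color j"
  shows "seg (code i) 1 = seg (code j) 1"
proof -
  have "tp LT M k {} = {\<phi> \<in> color k. fst (snd \<phi>) \<in> syms LT}" for k
    using syms_LT_subset arity_LT unfolding color_def tp_def by auto
  then show ?thesis
    using assms by (simp add: seg_code_1 del: One_nat_def)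
qed

text \<open>The largest parameter of the literal is \<open>i\<close>, so it belongs to the entry at
  \<open>Suc i = len (code i)\<close>, which \<open>code j\<close> has because
  \<open>i < j\<close>.\<close>

lemma literal_in_passing_iff:
  assumes "R \<in> syms LT" "length zs = arity LT R" "None \<in> set zs" "Some i \<in> set zs"
    and "set zs \<subseteq> insert None (Some ` insert i (coded A \<inter> {..<i}))" "i < j"
  shows "(True, R, zs) \<in> passing (code j) i A \<longleftrightarrow>
    holds M R (map (\<lambda>z. case z of None \<Rightarrow> j | Some a \<Rightarrow> a) zs)"
proof -
  have sub: "lit_params (True, R, zs) \<subseteq> insert i (coded A \<inter> {..<i})"
    using assms(5) by (simp only: lit_params_subset_iff)
  have "lit_params (True, R, zs) \<subseteq> {..<j}"
    using sub assms(6) by auto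
  then have "set zs \<subseteq> insert None (Some ` {..<j})"
    by (simp only: lit_params_subset_iff)
  moreover have "lit_params (True, R, zs) \<subseteq> {..i}" "i \<in> lit_params (True, R, zs)"
    using sub assms(4) by (auto simp: lit_params_def)
  ultimately show ?thesis
    using assms(1-3) sub by (simp add: passing_def len_code) (simp add: code_def tp_def)
qed

text \<open>Vertices are matched along the increasing enumerations of coding nodes. For a tuple of
  distinct vertices with largest element \<open>j\<close> and second largest \<open>i\<close>, the
  relation is a literal of \<open>code j\<close> with largest parameter \<open>i\<close>. It thus
  belongs to the passing type of \<open>code j\<close> at \<open>code i\<close>, which similarity
  preserves. Unary relations are read off the colors.\<close>

lemma similarity_map_imp_partial_iso:
  assumes f: "similarity_map S T f" and inf: "infinite (coded S)"
  shows "\<exists>g. partial_iso L M g (coded S) \<and> g ` coded S = coded T"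
proof -
  have "has_idx T n" for n
    using f inf by (auto simp: similarity_map_def has_idx_def)
  then have inf': "infinite (coded T)"
    unfolding has_idx_def by blast
  define e where "e = Infinite_Set.enumerate (coded S)"
  define e' where "e' = Infinite_Set.enumerate (coded T)"
  have e: "range e = coded S" "strict_mono e" and e': "range e' = coded T" "strict_mono e'"
    using inf inf' by (simp_all add: e_def e'_def range_enumerate strict_mono_enumerate)
  define g where "g = e' \<circ> inv_into UNIV e"
  have g_e: "g (e n) = e' n" for n
    using strict_mono_imp_inj_on[OF e(2)] by (simp add: g_def)
  have g_mono: "strict_mono_on (coded S) g"
    using e e' g_e by (auto simp: strict_mono_on_def strict_mono_less e(1)[symmetric])
  have sim: "f (code (e n)) = code (e' n)" "color (e n) = color (e' n)"
      "s \<in> S \<Longrightarrow> len (code (e n)) < len s \<Longrightarrow> passing_similar s (e n) S (f s) (e' n) T" for n s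
    using f inf
    unfolding similarity_map_def has_idx_def idx_def code_len_def e_def e'_def by auto
  have below: "coded S \<inter> {..<e n} = e ` {..<n}" "coded T \<inter> {..<e' n} = e' ` {..<n}" for n
    using e e' by (auto simp: strict_mono_less image_iff e(1)[symmetric] e'(1)[symmetric])
  have "partial_iso L M g (coded S)"
    unfolding partial_iso_def
  proof (intro conjI ballI allI impI)
    show "inj_on g (coded S)"
      using g_mono by (rule strict_mono_on_imp_inj_on)
    fix R ts assume R: "R \<in> syms L" and "length ts = arity L R \<and> set ts \<subseteq> coded S"
    then have ts: "length ts = arity L R" "set ts \<subseteq> coded S" by auto
    show "holds M R ts \<longleftrightarrow> holds M R (map g ts)"
    proof (cases "distinct ts")
      case False
      then show ?thesis
        using holds_distinct distinct_map by metis
    next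
      case distinct: True
      show ?thesis
      proof (cases "length ts = 1")
        case True
        then obtain n where n: "ts = [e n]"
          using ts(2) e(1) by (cases ts) auto
        have "(True, R, [None]) \<in> color k \<longleftrightarrow> holds M R [k]" for k
          using R ts(1) True by (simp add: color_def tp_def)
        then show ?thesis
          using sim(2)[of n] g_e n by (metis list.simps(8,9))
      next
        case False
        then have len: "arity L R > 1"
          using arity_pos[OF R] ts(1) by linarith
        then have R': "R \<in> syms LT"
          using R non_unary_syms_LT by blast
        define j where "j = Max (set ts)"
        have ne: "set ts \<noteq> {}"
          using len ts(1) by auto
        have j: "j \<in> set ts" "\<And>a. a \<in> set ts \<Longrightarrow> a \<le> j"
          using ne by (auto simp: j_def)
        have "card (set ts - {j}) > 0"
          using distinct len ts(1) j(1) by (simp add: distinct_card)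
        then have ne': "set ts - {j} \<noteq> {}"
          by (metis card.empty less_irrefl)
        define i where "i = Max (set ts - {j})"
        have i: "i \<in> set ts" "i \<noteq> j" "\<And>a. a \<in> set ts \<Longrightarrow> a \<noteq> j \<Longrightarrow> a \<le> i"
          using Max_in[OF _ ne'] by (auto simp: i_def)
        have ij: "i < j"
          using i j by (simp add: le_neq_implies_less)
        obtain n where n: "i = e n"
          using i(1) ts(2) e(1) by blast
        obtain m where m: "j = e m"
          using j(1) ts(2) e(1) by blast
        have gi: "g i = e' n" "g j = e' m"
          using g_e n m by auto
        have gij: "g i < g j"
          using ij i j ts(2) g_mono by (meson strict_mono_onD subsetD)
        have "code j \<in> S"
          using j(1) ts(2) by (auto simp: coded_def)
        then have "passing_similar (code j) i S (code (g j)) (g i) T"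
          using sim(1)[of m] sim(3)[of "code j" n] ij gi n m by (simp add: len_code)
        then obtain h where h: "bij_betw h (coded S \<inter> {..<i}) (coded T \<inter> {..<g i})"
            "strict_mono_on (coded S \<inter> {..<i}) h" "h i = g i"
          and pass: "\<And>zs. length zs = arity L R \<Longrightarrow> None \<in> set zs \<Longrightarrow>
             set zs \<subseteq> insert None (Some ` insert i (coded S \<inter> {..<i})) \<Longrightarrow>
             (True, R, zs) \<in> passing (code j) i S \<longleftrightarrow>
             (True, R, map (map_option h) zs) \<in> passing (code (g j)) (g i) T"
          unfolding passing_similar_def using R by blast
        have "g ` (coded S \<inter> {..<i}) = coded T \<inter> {..<g i}"
          using gi g_e by (simp add: n below image_image)
        \<comment> \<open>Both \<open>h\<close> and \<open>g\<close> are increasing on this set;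
          with equal images they must coincide there.\<close>
        then have im: "h ` (coded S \<inter> {..<i}) = g ` (coded S \<inter> {..<i})"
          using h(1) by (simp add: bij_betw_def)
        have "strict_mono_on (coded S \<inter> {..<i}) g"
          using g_mono by (auto simp: strict_mono_on_def)
        then have hg: "h a = g a" if "a \<in> coded S" "a \<le> i" for a
          using strict_mono_on_image_unique[OF h(2) _ im] h(3) that by (cases "a = i") auto
        \<comment> \<open>The largest vertex becomes the variable \<open>x\<close>, and the others
          stay parameters.\<close>
        define \<tau> where "\<tau> a = (if a = j then None else Some a)" for a
        define zs where "zs = map \<tau> ts"
        define zs' where "zs' = map (map_option h) zs"
        have \<tau>: "\<tau> j = None" "\<tau> i = Some i"
          using i(2) by (simp_all add: \<tau>_def)
        have \<tau>_sub: "\<tau> a \<in> insert None (Some ` insert i (coded S \<inter> {..<i}))" if "a \<in> set ts" for a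
          using that ts(2) i(3)[of a] by (cases "a = i") (auto simp: \<tau>_def)
        have zs: "length zs = arity L R" "None \<in> set zs" "Some i \<in> set zs"
            "set zs \<subseteq> insert None (Some ` insert i (coded S \<inter> {..<i}))"
        proof -
          show "length zs = arity L R"
            using ts(1) by (simp add: zs_def)
          show "None \<in> set zs" "Some i \<in> set zs"
            using \<tau>[symmetric] i(1) j(1) by (simp_all add: zs_def)
          show "set zs \<subseteq> insert None (Some ` insert i (coded S \<inter> {..<i}))"
            unfolding zs_def set_map using \<tau>_sub by (rule image_subsetI)
        qed
        have zs': "length zs' = arity L R" "None \<in> set zs'" "Some (g i) \<in> set zs'"
        proof -
          show "length zs' = arity L R" "None \<in> set zs'"
            using zs by (force simp: zs'_def)+
          show "Some (g i) \<in> set zs'"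
            using zs(3) h(3) by (force simp: zs'_def)
        qed
        have zs'_sub: "set zs' \<subseteq> insert None (Some ` insert (g i) (coded T \<inter> {..<g i}))"
        proof
          fix z assume "z \<in> set zs'"
          then obtain y where y: "y \<in> set zs" "z = map_option h y"
            by (auto simp: zs'_def)
          have "h a \<in> coded T \<inter> {..<g i}" if "a \<in> coded S \<inter> {..<i}" for a
            using h(1) that by (auto simp: bij_betw_def)
          then show "z \<in> insert None (Some ` insert (g i) (coded T \<inter> {..<g i}))"
            using y zs(4) h(3) by auto
        qed
        have "map (\<lambda>z. case z of None \<Rightarrow> j | Some a \<Rightarrow> a) zs = ts"
          by (auto simp: zs_def \<tau>_def intro: map_idI)
        moreover have "map (\<lambda>z. case z of None \<Rightarrow> g j | Some a \<Rightarrow> a) zs' = map g ts"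
          using hg i(3) ts(2) by (auto simp: zs'_def zs_def \<tau>_def)
        moreover have "(True, R, zs) \<in> passing (code j) i S \<longleftrightarrow>
            (True, R, zs') \<in> passing (code (g j)) (g i) T"
          unfolding zs'_def using pass zs by blast
        ultimately show ?thesis
          using literal_in_passing_iff[OF R' _ zs(2-4) ij]
            literal_in_passing_iff[OF R' _ zs'(2,3) zs'_sub gij] zs(1) zs'(1) arity_LT
          by simp
      qed
    qed
  qed
  moreover have "g ` coded S = coded T"
    using g_e by (simp add: e(1)[symmetric] e'(1)[symmetric] image_image)
  ultimately show ?thesis by blast
qed


text \<open>By the inclusion, vertex \<open>j\<close> satisfies the \<open>LT\<close>-type of
  \<open>i\<close> over all vertices before \<open>i\<close>. Symbols outside \<open>LT\<close> are
  unary, and the equality of colors takes care of them.\<close>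

lemma code_subset_imp_same_type:
  assumes "code i \<subseteq> code j" "color i = color j" "F \<subseteq> {..<i}"
  shows "i \<le> j" "same_type L M F j i"
proof -
  have ij: "i \<le> j" and eq: "node i i = node j i"
    using node_subset[OF assms(1)[unfolded code_def]] by blast+
  then show "i \<le> j" by simp
  show "same_type L M F j i"
    unfolding same_type_def partial_iso_def
  proof (intro conjI ballI allI impI)
    show "inj_on (id(j := i)) (insert j F)"
      using assms(3) ij by (auto simp: inj_on_def)
    fix R ts assume R: "R \<in> syms L" and ts: "length ts = arity L R \<and> set ts \<subseteq> insert j F"
    show "holds M R ts \<longleftrightarrow> holds M R (map (id(j := i)) ts)"
    proof (cases "j \<in> set ts")
      case False
      then have "map (id(j := i)) ts = ts"
        by (auto intro: map_idI)
      then show ?thesis by simp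
    next
      case j: True
      define zs where "zs = map (\<lambda>a. if a = j then None else Some a) ts"
      have zs: "length zs = arity L R" "None \<in> set zs" "set zs \<subseteq> insert None (Some ` {..<i})"
        using ts j assms(3) by (auto simp: zs_def)
      have map_zs: "map (\<lambda>z. case z of None \<Rightarrow> k | Some a \<Rightarrow> a) zs = map (id(j := k)) ts" for k
        by (auto simp: zs_def)
      show ?thesis
      proof (cases "R \<in> syms LT")
        case True
        then have "(holds M R (map (id(j := k)) ts), R, zs) \<in> node k i" for k
          using zs map_zs arity_LT by (simp add: tp_def)
        then have "(holds M R (map (id(j := j)) ts), R, zs) \<in> node i i"
          using eq by blast
        moreover have "id(j := j) = id" by auto
        ultimately show ?thesis
          using map_zs[of i] by (simp add: tp_def)
      next
        case False
        then have "arity L R = 1"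
          using R arity_pos non_unary_syms_LT by (metis le_neq_implies_less)
        then have "ts = [j]" "zs = [None]"
          using j ts by (auto simp: zs_def length_Suc_conv)
        moreover have "(holds M R [k], R, [None]) \<in> color k" for k
          using R \<open>arity L R = 1\<close> by (simp add: color_def tp_def)
        then have "(holds M R [j], R, [None]) \<in> color i"
          using assms(2) by metis
        ultimately show ?thesis
          by (simp add: color_def tp_def)
      qed
    qed
  qed
qed


section \<open>Moving a tree into a cone\<close>

lemma passing_similar_refl: "passing_similar s n A s n A"
  unfolding passing_similar_def
  by (rule exI[of _ id]) (auto simp: strict_mono_on_def option.map_id0)

lemma similarity_map_id: "meet_closed S \<Longrightarrow> similarity_map S S id"
  unfolding similarity_map_def using passing_similar_refl by auto

text \<open>Serves to keep only the critical levels of a tree, and then only those below a given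
  node. Comparable nodes meet in one of themselves, so the condition on meets concerns incomparable
  ones.\<close>

lemma subtree_restrict_lens:
  assumes T: "subtree T"
    and seg: "\<And>l t. l \<in> C \<Longrightarrow> t \<in> T \<Longrightarrow> l \<le> len t \<Longrightarrow> seg t l \<in> T"
    and meets: "\<And>s t. s \<in> T \<Longrightarrow> t \<in> T \<Longrightarrow> len s \<in> C \<Longrightarrow> len t \<in> C \<Longrightarrow> incomparable s t \<Longrightarrow>
      meet s t \<noteq> {} \<Longrightarrow> len (meet s t) \<in> C"
  shows "subtree {t \<in> T. len t \<in> C}"
proof -
  let ?A = "{t \<in> T. len t \<in> C}"
  have tree: "T \<subseteq> tree" and mc: "meet_closed T"
    using T by (auto simp: subtree_def)
  have "meet s t \<in> ?A" if st: "s \<in> ?A" "t \<in> ?A" "meet s t \<noteq> {}" for s t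
  proof (cases "incomparable s t")
    case True
    then show ?thesis
      using st meets mc by (auto simp: meet_closed_def)
  next
    case False
    then have "meet s t = s \<or> meet s t = t"
      using st tree meet_subset_eq[of s t] meet_subset_eq[of t s] meet_commute[of s t]
      by (auto simp: incomparable_def)
    then show ?thesis
      using st(1,2) by (elim disjE) simp_all
  qed
  then have "meet_closed ?A"
    unfolding meet_closed_def by blast
  moreover have "seg t l \<in> ?A" if "l \<in> C" "t \<in> ?A" "l \<le> len t" for l t
    using that seg tree len_seg[of t l] by auto
  moreover have "l \<in> C" if "(\<exists>i\<in>coded ?A. l = len (code i)) \<or>
      (\<exists>s\<in>?A. \<exists>t\<in>?A. incomparable s t \<and> meet s t \<noteq> {} \<and> l = len (meet s t))" for l
    using that meets by (auto simp: coded_def)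
  ultimately show ?thesis
    unfolding subtree_def using tree by blast
qed

text \<open>The Extension Property is used with \<open>T\<close> as its own ambient tree:
  \<open>A\<close> is \<open>T\<close> cut down to its critical levels, \<open>B\<close> is the part
  of \<open>A\<close> below the level of \<open>u\<close>, and the next splitting node is redirected
  from \<open>u\<close> to \<open>s'\<close>. The resulting copy \<open>A'\<close> of
  \<open>A\<close> serves as \<open>S\<close>, and \<open>len s'\<close> as
  \<open>N\<close>.\<close>

lemma extension_into_cone:
  assumes T: "subtree T" "perfect T" "infinite (coded T)" and EP: "EP T" and i: "i \<in> coded T"
  obtains S g N where "coded S \<subseteq> coded T" "partial_iso L M g (coded T)" "g ` coded T = coded S"
    "\<And>j. j \<in> coded S \<Longrightarrow> N < j \<Longrightarrow> seg (code j) 1 = seg (code i) 1 \<Longrightarrow> code i \<subseteq> code j"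
proof -
  have tree: "T \<subseteq> tree" and mc: "meet_closed T"
    using T(1) by (auto simp: subtree_def)
  have root_eq: "seg t 1 = seg s 1" if "s \<subseteq> t" "s \<in> tree" "t \<in> tree" for s t
    using that subset_iff_seg[OF that(2,3)] tree_len_pos[OF that(2)] seg_seg[of 1 "len s" t] by simp
  have splitting_in: "s \<in> T" if "splitting T s" for s
  proof -
    have "s \<in> tree"
      using that tree hat_subset_tree by (auto simp: splitting_def)
    then have "s \<noteq> {}"
      using tree_len_pos by force
    then show ?thesis
      using splitting_is_meet[OF tree that] mc unfolding meet_closed_def by metis
  qed
  have splitting_above: "\<exists>s. splitting T s \<and> t \<subseteq> s" if t: "t \<in> T" for t
  proof -
    obtain x y where xy: "x \<in> T" "y \<in> T" "t \<subseteq> x" "t \<subseteq> y" "incomparable x y"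
      using T(2)[unfolded perfect_def, THEN bspec, OF t] by blast
    have in_tree: "t \<in> tree" "x \<in> tree" "y \<in> tree"
      using t xy tree by auto
    have t_eq: "len t \<le> len x" "len t \<le> len y" "seg x (len t) = t" "seg y (len t) = t"
      using xy in_tree subset_iff_seg by blast+
    then have le: "len t \<le> meet_len x y"
      by (intro meet_len_ge) auto
    then have "t \<subseteq> meet x y"
      using t_eq(3) seg_seg[OF le, of x] seg_subset[of "meet x y" "len t"] by (simp add: meet_def)
    moreover from this have "meet x y \<noteq> {}"
      using tree_len_pos[OF in_tree(1)] by auto
    ultimately show ?thesis
      using splitting_meet[OF tree xy(1,2,5)] by blast
  qed

  define C where "C = {len t | t. t \<in> T \<and> (splitting T t \<or> t \<in> range code)}"
  have C_splitting: "len s \<in> C" if "splitting T s" for s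
    using that splitting_in by (auto simp: C_def)
  have C_seg: "seg t l \<in> T" if l: "l \<in> C" and t: "t \<in> T" "l \<le> len t" for l t
  proof -
    obtain c where c: "c \<in> T" "l = len c" "splitting T c \<or> c \<in> range code"
      using l by (auto simp: C_def)
    have "(\<exists>i\<in>coded T. l = len (code i)) \<or>
        (\<exists>s\<in>T. \<exists>t\<in>T. incomparable s t \<and> meet s t \<noteq> {} \<and> l = len (meet s t))"
    proof (cases "splitting T c")
      case True
      have "c \<noteq> {}"
        using c(1) tree tree_len_pos by force
      then show ?thesis
        using splitting_is_meet[OF tree True] c(2) by metis
    next
      case False
      then show ?thesis
        using c by (auto simp: coded_def)
    qed
    then show ?thesis
      using T(1) t unfolding subtree_def by blast
  qed
  have C_meet: "len (meet s t) \<in> C"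
    if "s \<in> T" "t \<in> T" "incomparable s t" "meet s t \<noteq> {}" for s t
    using C_splitting splitting_meet[OF tree that] by blast

  \<comment> \<open>\<open>EP\<close> speaks of trees that are the union of their initial parts, so
    the other levels are dropped. No coding node is lost, and by perfectness \<open>hat\<close> does
    not change either.\<close>
  define A where "A = {t \<in> T. len t \<in> C}"
  have A_sub: "A \<subseteq> T" by (auto simp: A_def)
  have A_subtree: "subtree A"
    unfolding A_def using C_seg C_meet by (intro subtree_restrict_lens[OF T(1)])
  have coded_A: "coded A = coded T"
    by (auto simp: coded_def A_def C_def)
  have hat_A: "hat A = hat T"
  proof
    show "hat A \<subseteq> hat T"
      using A_sub by (auto simp: hat_def)
    show "hat T \<subseteq> hat A"
    proof
      fix x assume "x \<in> hat T"
      then obtain t n where t: "x = seg t n" "t \<in> T" "1 \<le> n" "n \<le> len t"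
        by (auto simp: hat_def)
      obtain s where s: "splitting T s" "t \<subseteq> s"
        using splitting_above[OF t(2)] by blast
      then have "s \<in> A" "s \<in> tree"
        using splitting_in C_splitting tree by (auto simp: A_def)
      moreover have "len t \<le> len s" "seg s (len t) = t"
        using subset_iff_seg[of t s] s(2) t(2) tree \<open>s \<in> tree\<close> by auto
      moreover from this have "x = seg s n" "n \<le> len s"
        using t seg_seg[OF t(4), of s] by simp_all
      ultimately show "x \<in> hat A"
        using t(3) unfolding hat_def by blast
    qed
  qed
  have splitting_A: "splitting A = splitting T"
    by (simp add: splitting_def succs_def hat_A fun_eq_iff)
  \<comment> \<open>Coding nodes of unbounded length leave no terminal level, so the clause on
    \<open>max_nodes\<close> in \<open>critical_lens\<close> is void for \<open>A\<close>.\<close>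
  have "max_nodes A = {}"
  proof (rule ccontr)
    assume "max_nodes A \<noteq> {}"
    then obtain s where "s \<in> max_nodes A" by blast
    then have s: "\<And>t. t \<in> A \<Longrightarrow> len t \<le> len s"
      by (simp add: max_nodes_def)
    have "coded A \<subseteq> {..len s}"
    proof
      fix j assume "j \<in> coded A"
      then have "code j \<in> A"
        by (simp add: coded_def)
      from s[OF this] show "j \<in> {..len s}"
        by (simp add: len_code)
    qed
    then have "finite (coded A)"
      using finite_subset by blast
    then show False
      using T(3) coded_A by simp
  qed
  then have crit_A: "critical_lens T A = C"
    unfolding critical_lens_def splitting_A by (auto simp: A_def C_def)
  have finite_below: "finite {l \<in> D. l < n}" for D and n :: nat
    by simp
  \<comment> \<open>Comparing ranks among the critical lengths amounts to comparing lengths, which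
    turns the cardinalities in \<open>initial\<close> into bounds on \<open>len\<close>.\<close>
  have card_less_iff: "card {l \<in> C. l < a} < card {l \<in> C. l < b} \<longleftrightarrow> a < b" if "a \<in> C" for a b
  proof
    assume "a < b"
    then show "card {l \<in> C. l < a} < card {l \<in> C. l < b}"
      using that finite_below by (intro psubset_card_mono) auto
  next
    assume *: "card {l \<in> C. l < a} < card {l \<in> C. l < b}"
    show "a < b"
    proof (rule ccontr)
      assume "\<not> a < b"
      then have "card {l \<in> C. l < b} \<le> card {l \<in> C. l < a}"
        using finite_below by (intro card_mono) auto
      then show False
        using * by simp
    qed
  qed
  have initial_A: "initial T k A = {t \<in> A. card {l \<in> C. l < len t} < k}" for k
    unfolding initial_def crit_A by (auto simp: A_def)

  define r where "r = seg (code i) 1"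
  have code_i: "code i \<in> T" "code i \<in> tree"
    using i code_in_tree by (auto simp: coded_def)
  obtain s' where s': "splitting T s'" "code i \<subseteq> s'"
    using splitting_above[OF code_i(1)] by blast
  have s'_in: "s' \<in> T" "s' \<in> tree"
    using splitting_in[OF s'(1)] tree by auto
  have s'_root: "seg s' 1 = r"
    using root_eq[OF s'(2)] code_i s'_in by (simp add: r_def)
  obtain u where u: "splitting T u" "seg u 1 = r"
    and u_min: "\<And>s. splitting T s \<Longrightarrow> seg s 1 = r \<Longrightarrow> len u \<le> len s"
    using ex_has_least_nat[of "\<lambda>s. splitting T s \<and> seg s 1 = r" s' len] s'(1) s'_root by blast
  have u_in: "u \<in> T" "u \<in> tree" "u \<in> A" "len u \<in> C"
    using splitting_in[OF u(1)] C_splitting[OF u(1)] tree by (auto simp: A_def)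
  \<comment> \<open>If \<open>u\<close> were incomparable with \<open>s'\<close>, their meet would
    be a shorter splitting node with root \<open>r\<close>; if \<open>u\<close> extended
    \<open>s'\<close>, minimality would make the two equal.\<close>
  have u_sub: "u \<subseteq> s'"
  proof (rule ccontr)
    assume not_sub: "\<not> u \<subseteq> s'"
    show False
    proof (cases "s' \<subseteq> u")
      case True
      then have "seg u (len s') = s'"
        using subset_iff_seg s'_in u_in by blast
      moreover have "seg u (len s') = u"
        using seg_eq_self[OF u_in(2) u_min[OF s'(1) s'_root]] .
      ultimately show False
        using not_sub by simp
    next
      case False
      then have inc: "incomparable u s'"
        using not_sub by (simp add: incomparable_def)
      note meet = meet_nonempty[OF u_in(2) s'_in(2), unfolded u(2) s'_root, OF refl]
      have "len u \<le> len (meet u s')"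
        using u_min splitting_meet[OF tree u_in(1) s'_in(1) inc] meet by blast
      then show False
        using incomparable_meet(1)[OF u_in(2) s'_in(2) inc] by simp
    qed
  qed

  \<comment> \<open>The number of critical levels below \<open>u\<close>, so that \<open>u\<close>
    is on the last level of \<open>initial T (Suc k) A\<close>.\<close>
  define k where "k = card {l \<in> C. l < len u}"
  define B where "B = initial T k A"
  have B_eq: "B = {t \<in> A. len t < len u}"
    unfolding B_def initial_A k_def using card_less_iff by (auto simp: A_def)
  have initial_Suc: "initial T (Suc k) A = {t \<in> A. len t \<le> len u}"
    unfolding initial_A k_def less_Suc_eq_le
    using card_less_iff[OF u_in(4)] by (simp add: not_less[symmetric])
  have "subtree {t \<in> T. len t \<in> {l \<in> C. l < len u}}"
  proof (rule subtree_restrict_lens[OF T(1)])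
    show "seg t l \<in> T" if "l \<in> {l \<in> C. l < len u}" "t \<in> T" "l \<le> len t" for l t
      using that C_seg by blast
    fix s t assume *: "s \<in> T" "t \<in> T" "len s \<in> {l \<in> C. l < len u}" "len t \<in> {l \<in> C. l < len u}"
      "incomparable s t" "meet s t \<noteq> {}"
    then have "len (meet s t) < len s"
      using incomparable_meet(1) tree by blast
    then show "len (meet s t) \<in> {l \<in> C. l < len u}"
      using * C_meet by auto
  qed
  moreover have "B = {t \<in> T. len t \<in> {l \<in> C. l < len u}}"
    by (auto simp: B_eq A_def)
  ultimately have B_subtree: "subtree B" by simp
  have B_sub: "B \<subseteq> T"
    using A_sub by (auto simp: B_eq)
  have "similarity_map B B id"
    using B_subtree by (intro similarity_map_id) (simp add: subtree_def)
  then have B_similar: "plus_similar T B B"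
    unfolding plus_similar_def using B_subtree B_sub passing_similar_refl
    by (intro conjI exI[of _ id]) auto
  \<comment> \<open>If \<open>B\<close> is empty, this node is the root of \<open>u\<close>;
    otherwise it is the segment of \<open>u\<close> one step above the top level of
    \<open>B\<close>.\<close>
  have "\<exists>w\<in>max_succs T B. w \<subseteq> u"
  proof (cases "B = {}")
    case True
    have "seg u 1 \<in> at_len T 1"
      using u_in tree_len_pos[OF u_in(2)] len_seg[OF u_in(2), of 1]
      by (auto simp: at_len_def hat_def simp del: One_nat_def)
    then show ?thesis
      using True seg_subset by (auto simp: max_succs_def simp del: One_nat_def)
  next
    case False
    then obtain b0 where "b0 \<in> B" by blast
    moreover have "\<forall>t. t \<in> B \<longrightarrow> len t < len u"
      by (simp add: B_eq)
    ultimately obtain b where b: "b \<in> B" "\<And>t. t \<in> B \<Longrightarrow> len t \<le> len b"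
      using ex_has_greatest_nat[of "\<lambda>b. b \<in> B" b0 len "len u"] by blast
    let ?x = "seg u (len b)" and ?w = "seg u (Suc (len b))"
    have b': "len b < len u" "len b \<in> C"
      using b(1) by (auto simp: B_eq A_def)
    have lens: "len ?x = len b" "len ?w = Suc (len b)"
      using len_seg[OF u_in(2)] b' by auto
    have "?x \<in> T"
      using C_seg[OF b'(2) u_in(1)] b'(1) by simp
    then have "?x \<in> B"
      using b' lens by (simp add: B_eq A_def)
    then have "?x \<in> max_nodes B"
      using b(2) lens(1) by (simp add: max_nodes_def)
    moreover have "?w \<in> hat T"
      unfolding hat_def mem_Collect_eq
      by (intro exI[of _ u] exI[of _ "Suc (len b)"]) (use u_in(1) b'(1) in simp)
    then have "?w \<in> succs T ?x"
      using lens seg_subset[of ?w "len b"] seg_seg[of "len b" "Suc (len b)" u]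
      by (simp add: succs_def)
    ultimately have "?w \<in> max_succs T B"
      using False by (auto simp: max_succs_def)
    then show ?thesis
      using seg_subset by blast
  qed
  then obtain w where w: "w \<in> max_succs T B" "w \<subseteq> u" by blast
  \<comment> \<open>As \<open>B\<close> is its own copy, the identity is the required order
    isomorphism, and the node to be split is the one below \<open>u\<close>.\<close>
  have w_split: "to_be_split T B u B w"
    unfolding to_be_split_def by (rule exI[of _ id]) (use w in auto)
  have self: "T \<in> similar_subtrees T"
    using T(1) mc similarity_map_id unfolding similar_subtrees_def similar_def by blast
  have "A = (\<Union>j. initial T j A)"
    unfolding initial_A by auto
  moreover have "u \<in> initial T (Suc k) A" "u \<notin> B"
    using u_in by (auto simp: initial_Suc B_eq)
  moreover from this have "initial T (Suc k) A \<noteq> initial T k A"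
    unfolding B_def by blast
  moreover have "u \<in> max_nodes (initial T (Suc k) A)"
    using u_in unfolding initial_Suc by (simp add: max_nodes_def)
  ultimately have prems: "subtree A \<and> A \<subseteq> T \<and> A = (\<Union>j. initial T j A) \<and>
        initial T (Suc k) A \<noteq> initial T k A \<and>
        u \<in> max_nodes (initial T (Suc k) A) \<and> splitting T u \<and>
        plus_similar T (initial T k A) B \<and>
        to_be_split T (initial T k A) u B w \<and>
        splitting T s' \<and> w \<subseteq> s'"
    using A_subtree A_sub u(1) B_similar w_split s'(1) w(2) u_sub unfolding B_def by blast
  obtain X A' where X: "X \<subseteq> at_len T (len s')" "s' \<in> X"
    and A': "plus_similar T A A'" "initial T (Suc k) A' = B \<union> X"
    using EP[unfolded EP_def, rule_format, OF self prems] by blast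
  have A'_sub: "subtree A'" "A' \<subseteq> T"
    using A'(1) by (auto simp: plus_similar_def)
  then have A'_tree: "A' \<subseteq> tree" and A'_mc: "meet_closed A'"
    by (auto simp: subtree_def)
  \<comment> \<open>Similarity of \<open>A\<close> and \<open>A'\<close> gives the isomorphism, and
    \<open>A\<close> codes the same vertices as \<open>T\<close>.\<close>
  obtain g where g: "partial_iso L M g (coded T)" "g ` coded T = coded A'"
    using A'(1) similarity_map_imp_partial_iso[of A A'] coded_A T(3)
    unfolding plus_similar_def by metis
  have s'_A': "s' \<in> A'" "card {l \<in> critical_lens T A'. l < len s'} < Suc k"
    using X(2) A'(2) by (auto simp: initial_def)

  text \<open>If \<open>code j\<close> left \<open>s'\<close> below its end, it would do so at a splitting node of \<open>A'\<close> in \<open>B\<close>,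
    and this node would be shorter than \<open>u\<close>.\<close>
  have "s' \<subseteq> code j" if j: "j \<in> coded A'" "len s' < j" "seg (code j) 1 = r" for j
  proof (rule ccontr)
    assume not_sub: "\<not> s' \<subseteq> code j"
    have code_j: "code j \<in> A'" "code j \<in> tree"
      using j(1) code_in_tree by (auto simp: coded_def)
    have "\<not> code j \<subseteq> s'"
      using subset_iff_seg[OF code_j(2) s'_in(2)] j(2) len_code[of j] by simp
    then have inc: "incomparable (code j) s'"
      using not_sub by (simp add: incomparable_def)
    define y where "y = meet (code j) s'"
    have y: "y \<noteq> {}" "seg y 1 = r"
      using meet_nonempty[OF code_j(2) s'_in(2)] j(3) s'_root by (auto simp: y_def)
    have y_len: "len y < len s'"
      using incomparable_meet(2)[OF code_j(2) s'_in(2) inc] by (simp add: y_def)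
    have y_A': "y \<in> A'"
      using A'_mc code_j(1) s'_A'(1) y(1) unfolding meet_closed_def y_def by blast
    have "splitting A' y"
      using splitting_meet[OF A'_tree code_j(1) s'_A'(1) inc] y(1) by (simp add: y_def)
    then have "len y \<in> critical_lens T A'"
      using y_A' by (auto simp: critical_lens_def)
    moreover have "card {l \<in> critical_lens T A'. l < len y} \<le>
        card {l \<in> critical_lens T A'. l < len s'}"
      using y_len finite_below by (intro card_mono) auto
    ultimately have "y \<in> initial T (Suc k) A'"
      using y_A' s'_A'(2) by (simp add: initial_def)
    moreover have "y \<notin> X"
      using X(1) y_len by (auto simp: at_len_def)
    ultimately have "len y < len u"
      using A'(2) by (auto simp: B_eq)
    moreover have "splitting T y"
      using splitting_meet[OF tree _ s'_in(1) inc] code_j(1) A'_sub(2) y(1) by (auto simp: y_def)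
    ultimately show False
      using u_min[of y] y(2) by simp
  qed
  then have "code i \<subseteq> code j" if "j \<in> coded A'" "len s' < j" "seg (code j) 1 = seg (code i) 1" for j
    using that s'(2) unfolding r_def by blast
  moreover have "coded A' \<subseteq> coded T"
    using A'_sub(2) by (auto simp: coded_def)
  ultimately show ?thesis
    using that g by blast
qed

end


section \<open>Indivisibility\<close>

lemma same_type_imp_tp_eq:
  assumes "same_type L K {} i j"
  shows "tp L K i {} = tp L K j {}"
proof -
  have "holds K R (map (\<lambda>z. case z of None \<Rightarrow> i | Some a \<Rightarrow> a) zs) \<longleftrightarrow>
      holds K R (map (\<lambda>z. case z of None \<Rightarrow> j | Some a \<Rightarrow> a) zs)"
    if "R \<in> syms L" "length zs = arity L R" "set zs \<subseteq> {None}" for R zs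
  proof -
    have eq: "map (\<lambda>z. case z of None \<Rightarrow> l | Some a \<Rightarrow> a) zs = map (\<lambda>_. l) zs" for l
      using that(3) by auto
    have "holds K R (map (id(i := j)) (map (\<lambda>_. i) zs)) \<longleftrightarrow> holds K R (map (\<lambda>_. i) zs)"
      using assms that unfolding same_type_def by (intro partial_isoD(2)) auto
    then show ?thesis
      by (simp add: eq comp_def)
  qed
  then show ?thesis
    unfolding tp_def by auto
qed

context fraisse_limit
begin

text \<open>\<open>Y\<close> drops the vertices of the color of \<open>a\<close> outside
  \<open>U\<close>. If a type over a finite \<open>F\<close> is not realized in \<open>Y\<close>,
  all its realizations in \<open>coded T\<close> are dropped vertices. Vertices of this color coded
  above such a realization \<open>i\<close>, chosen beyond \<open>F\<close>, inherit its type over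
  \<open>F\<close> and so lie outside \<open>U\<close>.\<close>

lemma copy_within_or_avoiding:
  assumes LT: "conventional_coding_tree L LT K"
    and T: "coding_tree.perfect_diagonal_coding_subtree L LT K T"
    and EP: "coding_tree.EP L LT ord K T"
  obtains Y where "copy Y"
    "(\<forall>y\<in>Y. same_type L K {} y a \<longrightarrow> y \<in> U) \<or> (\<forall>y\<in>Y. same_type L K {} y a \<longrightarrow> y \<notin> U)"
proof -
  interpret conventional_coding_tree L LT ord K by (rule LT)
  have T': "subtree T" "perfect T" "copy (coded T)"
    using T unfolding perfect_diagonal_coding_subtree_def diagonal_coding_subtree_def copy_def
    by auto
  define Y where "Y = {z \<in> coded T. same_type L K {} z a \<longrightarrow> z \<in> U}"
  show ?thesis
  proof (cases "\<forall>F v. finite F \<longrightarrow> F \<subseteq> Y \<longrightarrow> v \<notin> F \<longrightarrow> (\<exists>y\<in>Y. y \<notin> F \<and> same_type L K F y v)")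
    case True
    then have "copy Y"
      by (intro copyI) blast
    then show ?thesis
      using that unfolding Y_def by blast
  next
    case False
    then obtain F v where F: "finite F" "F \<subseteq> Y" "v \<notin> F"
      and no_real: "\<And>y. y \<in> Y \<Longrightarrow> y \<notin> F \<Longrightarrow> \<not> same_type L K F y v"
      by blast
    obtain m where m: "F \<subseteq> {..m}"
      using F(1) finite_nat_set_iff_bounded_le by (metis atMost_iff subsetI)
    have "F \<subseteq> coded T"
      using F(2) by (auto simp: Y_def)
    \<comment> \<open>An index beyond \<open>F\<close> makes every element of \<open>F\<close> a
      parameter of \<open>code i\<close>.\<close>
    then obtain i where i: "i \<in> coded T" "i \<notin> F" "i \<notin> {..m}" "same_type L K F i v"
      using copy_realizes_types[OF T'(3) F(1) _ _ F(3), of "{..m}"] by blast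
    have Fi: "F \<subseteq> {..<i}"
      using m i(3) by auto
    have ia: "same_type L K {} i a"
      using no_real[of i] i unfolding Y_def by blast
    obtain S g N where S: "coded S \<subseteq> coded T" "partial_iso L K g (coded T)" "g ` coded T = coded S"
      "\<And>j. j \<in> coded S \<Longrightarrow> N < j \<Longrightarrow> seg (code j) 1 = seg (code i) 1 \<Longrightarrow> code i \<subseteq> code j"
      using extension_into_cone[OF T'(1,2) copy_infinite[OF T'(3)] EP i(1)] by blast
    \<comment> \<open>Only coding nodes with index above \<open>N\<close> are known to enter the
      cone, so the finitely many others are removed.\<close>
    have "copy (coded S - {..N})"
      using copy_image[OF T'(3) S(2)] S(3) by (intro copy_diff_finite) auto
    moreover have "y \<notin> U" if y: "y \<in> coded S - {..N}" "same_type L K {} y a" for y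
    proof -
      have col: "color i = color y"
        using same_type_imp_tp_eq[OF ia] same_type_imp_tp_eq[OF y(2)] by (simp add: color_def)
      then have "code i \<subseteq> code y"
        using S(4)[of y] y(1) color_eq_imp_seg_eq[OF col] by auto
      note yi = code_subset_imp_same_type[OF this col Fi]
      have "y \<notin> F"
        using yi(1) Fi by auto
      then have "same_type L K F y v"
        using same_type_trans[OF _ i(2) yi(2) i(4)] by blast
      then have "y \<notin> Y"
        using no_real \<open>y \<notin> F\<close> by blast
      then show ?thesis
        using y S(1) by (auto simp: Y_def)
    qed
    ultimately show ?thesis
      using that by blast
  qed
qed

text \<open>Induction on the number of colors, where \<open>split\<close> decides about the last
  one. It yields copies inside \<open>K\<close> rather than inside \<open>Y\<close>, so the coloring
  is pulled back along an embedding \<open>g\<close> of \<open>K\<close> with range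
  \<open>Y\<close>. For \<open>l = 0\<close> no vertex of \<open>Y\<close> has the type of
  \<open>a\<close>.\<close>

lemma monochromatic_copy:
  fixes \<chi> :: "nat \<Rightarrow> nat"
  assumes split: "\<And>U. \<exists>Y. copy Y \<and> ((\<forall>y\<in>Y. same_type L K {} y a \<longrightarrow> y \<in> U) \<or>
      (\<forall>y\<in>Y. same_type L K {} y a \<longrightarrow> y \<notin> U))"
    and "copy Y" "\<And>y. y \<in> Y \<Longrightarrow> same_type L K {} y a \<Longrightarrow> \<chi> y < l"
  shows "\<exists>Z. copy Z \<and> (\<forall>y\<in>Z. \<forall>z\<in>Z. same_type L K {} y a \<longrightarrow> same_type L K {} z a \<longrightarrow> \<chi> y = \<chi> z)"
  using assms(2,3)
proof (induction l arbitrary: Y)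
  case 0
  then show ?case by blast
next
  case (Suc l)
  obtain g where g: "partial_iso L K g UNIV" "range g = Y"
    using Suc.prems(1) copy_iff' by blast
  have yg: "same_type L K {} y (g y)" for y
    by (subst same_type_iff[where f = g]) (use partial_iso_subset[OF g(1)] in auto)
  have ga: "same_type L K {} y a" if "same_type L K {} (g y) a" for y
    using same_type_trans[OF _ _ yg that] by simp
  obtain Y0 where Y0: "copy Y0"
    "(\<forall>y\<in>Y0. same_type L K {} y a \<longrightarrow> \<chi> (g y) = l) \<or>
     (\<forall>y\<in>Y0. same_type L K {} y a \<longrightarrow> \<chi> (g y) \<noteq> l)"
    using split[of "{y. \<chi> (g y) = l}"] by blast
  have copy: "copy (g ` Y0)"
    using copy_image[OF Y0(1)] g(1) partial_iso_subset by blast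
  from Y0(2) show ?case
  proof
    assume "\<forall>y\<in>Y0. same_type L K {} y a \<longrightarrow> \<chi> (g y) = l"
    then show ?thesis
      using copy ga by (intro exI[of _ "g ` Y0"]) auto
  next
    assume *: "\<forall>y\<in>Y0. same_type L K {} y a \<longrightarrow> \<chi> (g y) \<noteq> l"
    have "\<chi> y < l" if y: "y \<in> g ` Y0" "same_type L K {} y a" for y
    proof -
      have "\<chi> y < Suc l"
        using Suc.prems(2) y g(2) by blast
      moreover have "\<chi> y \<noteq> l"
        using * y ga by blast
      ultimately show ?thesis by simp
    qed
    then show ?thesis
      using Suc.IH copy by blast
  qed
qed

text \<open>Copies of the substructure on \<open>{a}\<close> are the substructures on
  \<open>{y}\<close> with \<open>y\<close> of the same parameter-free type as \<open>a\<close>, so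
  coloring copies amounts to coloring these vertices.\<close>

lemma indivisibleI:
  assumes split: "\<And>a U. \<exists>Y. copy Y \<and> ((\<forall>y\<in>Y. same_type L K {} y a \<longrightarrow> y \<in> U) \<or>
      (\<forall>y\<in>Y. same_type L K {} y a \<longrightarrow> y \<notin> U))"
  shows "indivisible L K"
  unfolding indivisible_def
proof (intro allI impI)
  fix A :: "('r, nat) struct" and l :: nat and \<chi> :: "('r, nat) struct \<Rightarrow> nat"
  assume "substructure A K \<and> card (univ A) = 1"
  then obtain a where A: "A = induced K {a}"
    unfolding substructure_def by (metis card_1_singletonE)
  assume *: "0 < l \<and> (\<forall>N\<in>copies L A K. \<chi> N < l)"
  have bound: "\<chi> (induced K {y}) < l" if "same_type L K {} y a" for y
  proof -
    have "isomorphism L (id(y := a)) (induced K {y}) (induced K {a})"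
      using that by (simp add: isomorphism_induced_iff[OF univ_K] same_type_def)
    moreover have "substructure (induced K {y}) K"
      using univ_K by (simp add: substructure_def)
    ultimately show ?thesis
      using * A unfolding copies_def isomorphic_def by blast
  qed
  have "copy UNIV"
    by (auto simp: copy_iff' partial_iso_def intro: exI[of _ id])
  then obtain Y where Y: "copy Y"
    "\<And>y z. y \<in> Y \<Longrightarrow> z \<in> Y \<Longrightarrow> same_type L K {} y a \<Longrightarrow> same_type L K {} z a \<Longrightarrow>
       \<chi> (induced K {y}) = \<chi> (induced K {z})"
    using monochromatic_copy[OF split, of UNIV a "\<lambda>y. \<chi> (induced K {y})" l] bound by metis
  have N: "\<exists>y\<in>Y. N = induced K {y} \<and> same_type L K {} y a"
    if "N \<in> copies L A (induced K Y)" for N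
  proof -
    have sub: "univ N \<subseteq> Y" "N = induced (induced K Y) (univ N)" and "isomorphic L N A"
      using that univ_K by (auto simp: copies_def substructure_def)
    then obtain f where f: "isomorphism L f N (induced K {a})"
      using A isomorphic_def by blast
    have "induced (induced K Y) (univ N) = induced K (univ N)"
      using sub(1) univ_K by (auto simp: induced_def fun_eq_iff)
    with sub(2) have N_eq: "N = induced K (univ N)"
      by (rule trans)
    then have f': "partial_iso L K f (univ N)" "f ` univ N = {a}"
      using f isomorphism_induced_iff[OF univ_K, of L f "univ N" "{a}"] by auto
    then obtain y where y: "y \<in> univ N" "f y = a" by blast
    have "univ N = {y}"
      using f' y partial_isoD(1)[OF f'(1)] by (auto simp: inj_on_def)
    moreover from this have "same_type L K {} y a"
      by (subst same_type_iff[where f = f]) (use f' y in auto)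
    ultimately show ?thesis
      using N_eq sub(1) by auto
  qed
  have "substructure (induced K Y) K"
    using univ_K by (simp add: substructure_def)
  then show "\<exists>K'. substructure K' K \<and> isomorphic L K' K \<and>
      (\<forall>N\<in>copies L A K'. \<forall>N'\<in>copies L A K'. \<chi> N = \<chi> N')"
    using Y N unfolding copy_def by metis
qed

end

theorem theorem1p2:
  fixes L :: "'r lang" and ord :: "(bool \<times> 'r) rel"
    and \<K> :: "('r, nat) struct set" and K :: "('r, nat) struct"
  assumes "relational_language L"
    and "fraisse_class L \<K>"
    and "enumerated_fraisse_limit L \<K> K"
    and "standing_conventions L \<K> K"
    and "symbol_order L ord"
    and "SDAP_plus L ord K"
  shows "indivisible L K"
proof -
  have K: "structure_for L K" "univ K = UNIV" "age L K = \<K>" "ultrahomogeneous L K"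
    using assms(3) by (simp_all add: enumerated_fraisse_limit_def)
  have "disjoint_amalgamation_property L \<K>"
    using assms(2) by (simp add: fraisse_class_def)
  then interpret fraisse_limit L K
    by unfold_locales (simp_all add: K)
  have arity_L: "\<forall>R\<in>syms L. 1 \<le> arity L R" "\<exists>R\<in>syms L. 1 < arity L R"
    using assms(1) by (auto simp: relational_language_def)
  have distinct: "\<And>R ts. holds K R ts \<Longrightarrow> distinct ts"
    using assms(4) unfolding standing_conventions_def by blast
  \<comment> \<open>Both kinds of tree in \<open>extension_property\<close> fit the locale, so one
    argument treats both.\<close>
  have tree: "conventional_coding_tree L L K" "conventional_coding_tree L (non_unary L) K"
    by (unfold_locales; use arity_L distinct univ_K in \<open>auto simp: non_unary_def\<close>)+
  obtain LT T where "conventional_coding_tree L LT K"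
      "coding_tree.perfect_diagonal_coding_subtree L LT K T" "coding_tree.EP L LT ord K T"
    using assms(6) tree unfolding SDAP_plus_def extension_property_def by blast
  then show ?thesis
    by (intro indivisibleI) (rule copy_within_or_avoiding, assumption+, blast)
qed

end
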